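(* Let $\Bbbk$ be $\mathbb Q$ or $\mathbb F_p$ ($p$ prime), and let $G$ be a finitely generated group which is residually nilpotent if $\Bbbk=\mathbb Q$ and residually-$p$ if $\Bbbk=\mathbb F_p$. Let $b_n=b_n(G)=\operatorname{rank}(G_n/G_{n+1})$, where $\{G_n\}$ is the series of $\Bbbk$-dimension subgroups of $G$. If there exist $C>0$ and $d\ge0$ such that $b_n\ge Cn^d$ for all $n\ge1$, then $\gamma_G(n)\succsim e^{n^{1-1/(d+2)}}$. In particular, if $b_n\ne0$ for all $n\ge1$, then $\gamma_G(n)\succsim e^{\sqrt n}$.
   Context: $G_n=\{g\in G: g-1\in\Delta^n\}$, where $\Delta$ is the augmentation ideal of the group algebra $\Bbbk[G]$. The rank of an abelian group $M$ is $\dim_{\Bbbk}(M\otimes_{\mathbb Z}\Bbbk)$. For a finite set $S$ generating $G$ as a semigroup, $\gamma_G^S(n)$ is the number of elements of $G$ that are products of at most $n$ elements of $S$. For functions $f,g:\mathbb R_+\to\mathbb R_+$ write $f\precsim g$ (equivalently $g\succsim f$) if there is a constant $C>0$ with $f(x)\le C+Cg(Cx+C)$ for all $x\in\mathbb R_+$, and $f\sim g$ if $f\precsim g$ and $g\precsim f$; a sequence $\{a_n\}$ is viewed as the function $x\mapsto a_{\lfloor x\rfloor}$. The $\sim$-class of $\gamma_G^S$ does not depend on $S$ and is denoted $\gamma_G$. *)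

theory Defs
  imports
    Complex_Main
    "HOL-Algebra.Free_Abelian_Groups"
    "HOL-Algebra.Ideal_Product"
    "HOL-Algebra.QuotRing"
    "HOL-Algebra.Generated_Groups"
    "HOL-Algebra.Algebraic_Closure_Type"
    "HOL-Number_Theory.Residues"
    "Jordan_Normal_Form.Missing_VectorSpace"
begin

section \<open>Group algebras and dimension subgroups\<close>

text \<open>
  An element of the group algebra is a finitely supported function, extended by zero outside
  \<open>carrier G\<close>; multiplication is convolution, summed over the pairs of support points.
\<close>

definition group_algebra ::
  "('k, 'c) ring_scheme \<Rightarrow> ('g, 'd) monoid_scheme \<Rightarrow> ('k, 'g \<Rightarrow> 'k) module"
  where "group_algebra K G =
    \<lparr>carrier = {f. (\<forall>x. f x \<in> carrier K) \<and> (\<forall>x. x \<notin> carrier G \<longrightarrow> f x = \<zero>\<^bsub>K\<^esub>)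
                 \<and> finite {x. f x \<noteq> \<zero>\<^bsub>K\<^esub>}},
     monoid.mult = (\<lambda>f h x. \<Oplus>\<^bsub>K\<^esub>ab \<in> {ab \<in> carrier G \<times> carrier G.
        f (fst ab) \<noteq> \<zero>\<^bsub>K\<^esub> \<and> h (snd ab) \<noteq> \<zero>\<^bsub>K\<^esub> \<and> fst ab \<otimes>\<^bsub>G\<^esub> snd ab = x}.
        f (fst ab) \<otimes>\<^bsub>K\<^esub> h (snd ab)),
     one = (\<lambda>x. if x = \<one>\<^bsub>G\<^esub> then \<one>\<^bsub>K\<^esub> else \<zero>\<^bsub>K\<^esub>),
     ring.zero = (\<lambda>x. \<zero>\<^bsub>K\<^esub>),
     add = (\<lambda>f h x. f x \<oplus>\<^bsub>K\<^esub> h x),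
     module.smult = (\<lambda>c f x. c \<otimes>\<^bsub>K\<^esub> f x)\<rparr>"

definition group_algebra_of :: "('k, 'c) ring_scheme \<Rightarrow> 'g \<Rightarrow> ('g \<Rightarrow> 'k)"
  where "group_algebra_of K g = (\<lambda>x. if x = g then \<one>\<^bsub>K\<^esub> else \<zero>\<^bsub>K\<^esub>)"

definition augmentation :: "('k, 'c) ring_scheme \<Rightarrow> ('g \<Rightarrow> 'k) \<Rightarrow> 'k"
  where "augmentation K f = (\<Oplus>\<^bsub>K\<^esub>x \<in> {x. f x \<noteq> \<zero>\<^bsub>K\<^esub>}. f x)"

definition augmentation_ideal ::
  "('k, 'c) ring_scheme \<Rightarrow> ('g, 'd) monoid_scheme \<Rightarrow> ('g \<Rightarrow> 'k) set"
  where "augmentation_ideal K G = a_kernel (group_algebra K G) K (augmentation K)"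

text \<open>
  The powers of the augmentation ideal are taken with respect to the product of ideals; the
  zeroth power is the whole algebra.
\<close>

definition dimension_subgroup ::
  "('k, 'c) ring_scheme \<Rightarrow> ('g, 'd) monoid_scheme \<Rightarrow> nat \<Rightarrow> 'g set"
  where "dimension_subgroup K G n =
    {g \<in> carrier G. group_algebra_of K g \<ominus>\<^bsub>group_algebra K G\<^esub> \<one>\<^bsub>group_algebra K G\<^esub>
        \<in> augmentation_ideal K G [^]\<^bsub>ideals_set (group_algebra K G)\<^esub> n}"


section \<open>Extension of scalars and rank of an abelian group\<close>

text \<open>
  For a multiplicatively written abelian group \<open>M\<close>, the tensor product of \<open>M\<close> and \<open>K\<close> over
  the integers is the free abelian group on the pairs \<open>(m, x)\<close> modulo the relations of
  biadditivity, with \<open>K\<close> acting through the second factor.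
\<close>

definition tensor_relations ::
  "('m, 'c) monoid_scheme \<Rightarrow> ('k, 'd) ring_scheme \<Rightarrow> ('m \<times> 'k \<Rightarrow>\<^sub>0 int) set"
  where "tensor_relations M K = generate (free_Abelian_group (carrier M \<times> carrier K))
    ({frag_of (m \<otimes>\<^bsub>M\<^esub> m', x) - frag_of (m, x) - frag_of (m', x) | m m' x.
        m \<in> carrier M \<and> m' \<in> carrier M \<and> x \<in> carrier K} \<union>
     {frag_of (m, x \<oplus>\<^bsub>K\<^esub> y) - frag_of (m, x) - frag_of (m, y) | m x y.
        m \<in> carrier M \<and> x \<in> carrier K \<and> y \<in> carrier K})"

definition tensor_group ::
  "('m, 'c) monoid_scheme \<Rightarrow> ('k, 'd) ring_scheme \<Rightarrow> ('m \<times> 'k \<Rightarrow>\<^sub>0 int) set monoid"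
  where "tensor_group M K =
    free_Abelian_group (carrier M \<times> carrier K) Mod tensor_relations M K"

text \<open>
  As a \<open>K\<close>-module; the fields \<open>mult\<close> and \<open>one\<close> of the record play no role in a module.
\<close>

definition tensor_module ::
  "('m, 'c) monoid_scheme \<Rightarrow> ('k, 'd) ring_scheme \<Rightarrow> ('k, ('m \<times> 'k \<Rightarrow>\<^sub>0 int) set) module"
  where "tensor_module M K =
    \<lparr>carrier = carrier (tensor_group M K),
     monoid.mult = undefined,
     one = undefined,
     ring.zero = \<one>\<^bsub>tensor_group M K\<^esub>,
     add = monoid.mult (tensor_group M K),
     module.smult = (\<lambda>c u. \<Union>f \<in> u.
        tensor_relations M K #>\<^bsub>free_Abelian_group (carrier M \<times> carrier K)\<^esub>
          frag_extend (\<lambda>(m, x). frag_of (m, c \<otimes>\<^bsub>K\<^esub> x)) f)\<rparr>"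

text \<open>
  \<open>vectorspace.dim\<close> is specified only in finite dimension. The sections of the dimension series
  of a finitely generated group, from the first one on, have finite rank.
\<close>

definition abelian_rank ::
  "('k, 'd) ring_scheme \<Rightarrow> ('m, 'c) monoid_scheme \<Rightarrow> nat"
  where "abelian_rank K M = vectorspace.dim K (tensor_module M K)"

definition dimension_rank ::
  "('k, 'c) ring_scheme \<Rightarrow> ('g, 'd) monoid_scheme \<Rightarrow> nat \<Rightarrow> nat"
  where "dimension_rank K G n =
    abelian_rank K (G\<lparr>carrier := dimension_subgroup K G n\<rparr> Mod dimension_subgroup K G (n + 1))"


section \<open>Residual properties\<close>

definition finitely_generated_group :: "('g, 'd) monoid_scheme \<Rightarrow> bool"
  where "finitely_generated_group G \<longleftrightarrow>
    group G \<and> (\<exists>S. finite S \<and> S \<subseteq> carrier G \<and> generate G S = carrier G)"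

text \<open>The numbering starts at zero: \<open>lower_central G 0\<close> is the whole group.\<close>

primrec lower_central :: "('g, 'd) monoid_scheme \<Rightarrow> nat \<Rightarrow> 'g set"
  where
    "lower_central G 0 = carrier G"
  | "lower_central G (Suc n) = generate G (\<Union>x \<in> lower_central G n. \<Union>y \<in> carrier G.
       {x \<otimes>\<^bsub>G\<^esub> y \<otimes>\<^bsub>G\<^esub> inv\<^bsub>G\<^esub> x \<otimes>\<^bsub>G\<^esub> inv\<^bsub>G\<^esub> y})"

definition nilpotent_group :: "('g, 'd) monoid_scheme \<Rightarrow> bool"
  where "nilpotent_group G \<longleftrightarrow> group G \<and> (\<exists>c. lower_central G c = {\<one>\<^bsub>G\<^esub>})"

definition finite_p_group :: "nat \<Rightarrow> ('g, 'd) monoid_scheme \<Rightarrow> bool"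
  where "finite_p_group p G \<longleftrightarrow> group G \<and> finite (carrier G) \<and> (\<exists>k. Coset.order G = p ^ k)"

definition residually :: "('g set monoid \<Rightarrow> bool) \<Rightarrow> ('g, 'd) monoid_scheme \<Rightarrow> bool"
  where "residually P G \<longleftrightarrow>
    (\<forall>g \<in> carrier G. g \<noteq> \<one>\<^bsub>G\<^esub> \<longrightarrow> (\<exists>N. N \<lhd> G \<and> P (G Mod N) \<and> g \<notin> N))"


section \<open>Growth\<close>

definition word_product :: "('g, 'd) monoid_scheme \<Rightarrow> 'g list \<Rightarrow> 'g"
  where "word_product G w = foldr (\<lambda>x y. x \<otimes>\<^bsub>G\<^esub> y) w \<one>\<^bsub>G\<^esub>"

definition generates_as_semigroup :: "('g, 'd) monoid_scheme \<Rightarrow> 'g set \<Rightarrow> bool"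
  where "generates_as_semigroup G S \<longleftrightarrow>
    S \<subseteq> carrier G \<and> carrier G \<subseteq> {word_product G w | w. w \<noteq> [] \<and> set w \<subseteq> S}"

text \<open>
  The empty product is counted in the ball; this changes the growth function by at most one
  and hence does not affect its equivalence class.
\<close>

definition growth_function :: "('g, 'd) monoid_scheme \<Rightarrow> 'g set \<Rightarrow> nat \<Rightarrow> nat"
  where "growth_function G S n = card {word_product G w | w. set w \<subseteq> S \<and> length w \<le> n}"

definition asymp_dominated :: "(real \<Rightarrow> real) \<Rightarrow> (real \<Rightarrow> real) \<Rightarrow> bool"
  where "asymp_dominated f g \<longleftrightarrow> (\<exists>C > 0. \<forall>x \<ge> 0. f x \<le> C + C * g (C * x + C))"

definition seq_fun :: "(nat \<Rightarrow> real) \<Rightarrow> real \<Rightarrow> real"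
  where "seq_fun a x = a (nat \<lfloor>x\<rfloor>)"

text \<open>
  Since the equivalence class of the growth function does not depend on the generating set,
  a lower bound for the growth of \<open>G\<close> is a bound valid for every finite semigroup generating set.
\<close>

definition growth_dominates :: "('g, 'd) monoid_scheme \<Rightarrow> (nat \<Rightarrow> real) \<Rightarrow> bool"
  where "growth_dominates G a \<longleftrightarrow>
    (\<forall>S. finite S \<and> generates_as_semigroup G S \<longrightarrow>
       asymp_dominated (seq_fun a) (seq_fun (\<lambda>n. real (growth_function G S n))))"

end

theory Submission
  imports Defs
begin

text \<open>
  The growth of \<open>G\<close> is bounded below by the number of linearly independent polynomial functions on
  \<open>G\<close>. A function \<open>\<phi>\<close> from \<open>G\<close> to \<open>K\<close> is polynomial of degree less than \<open>n\<close> if every iteration of \<open>n\<close>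
  right differences \<open>x \<mapsto> \<phi> (x h) - \<phi> x\<close> kills it; equivalently, its linear extension to the group
  algebra vanishes on the \<open>n\<close>-th power of the augmentation ideal. Two properties matter. A polynomial
  function of degree at most \<open>N\<close> that vanishes on the ball of radius \<open>N\<close> is zero
  (\<open>poly_fun_eq_zero\<close>), so the ball has at least as many points as there are independent functions of
  that degree. And degrees add under multiplication (\<open>poly_fun_mult\<close>), so that many functions arise
  as products of few.

  The factors come from the dimension series. Duality identifies \<open>G\<^sub>n\<close> with the set of elements that
  functions of degree less than \<open>n\<close> cannot tell from the identity
  (\<open>dimension_subgroup_iff_poly_fun\<close>), and a function of degree at most \<open>n\<close> that vanishes at the
  identity is additive on \<open>G\<^sub>n\<close>. If \<open>G\<^sub>n/G\<^sub>n\<^sub>+\<^sub>1\<close> has rank at least \<open>r\<close>, there are \<open>r\<close> elements of \<open>G\<^sub>n\<close>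
  and \<open>r\<close> functions of degree at most \<open>n\<close> with a unitriangular matrix of values: as \<open>K\<close> is a prime
  field, the elements of a maximal such system span the tensor product of \<open>G\<^sub>n/G\<^sub>n\<^sub>+\<^sub>1\<close> with \<open>K\<close>
  (\<open>dimension_rank_le\<close>).

  Now list the pairs \<open>(g\<^sub>i, \<phi>\<^sub>i)\<close> of several levels in increasing order. Right multiplication by \<open>g\<^sub>j\<close>
  adds \<open>1\<close> to \<open>\<phi>\<^sub>j\<close> and does not change \<open>\<phi>\<^sub>i\<close> for \<open>i < j\<close>, and this forces the products of \<open>\<phi>\<^sub>i\<close>
  over subsets of the list to be linearly independent (\<open>monomials_independent\<close>). It is the
  dual form of the fact that in the graded ring of the group algebra, which Jennings and Quillen
  identified with an enveloping algebra, ordered square-free products of independent elements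
  \<open>g\<^sub>i - 1\<close> are independent.

  So \<open>L\<close> pairs with total degree \<open>W\<close> give \<open>2\<^sup>L\<close> points in the ball of radius \<open>W\<close>. With about \<open>C m\<^sup>d\<close> pairs on each of the
  levels from \<open>m\<close> to \<open>2 m - 1\<close>, \<open>L\<close> has the order of \<open>m\<close> to the power \<open>d + 1\<close> and \<open>W\<close> that of \<open>m\<close> to
  the power \<open>d + 2\<close>, which is the claim (\<open>exp_power_dominated\<close>).
\<close>

section \<open>Polynomial functions on a group\<close>

text \<open>
  All functions below are total on the underlying types; only their values on \<open>carrier G\<close> matter,
  hence the congruence lemmas that replace a function by one that agrees with it there.
\<close>

locale field_and_group = K: field K + G: group G
  for K :: "('k, 'c) ring_scheme" and G :: "('g, 'd) monoid_scheme"
begin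

definition right_diff :: "'g \<Rightarrow> ('g \<Rightarrow> 'k) \<Rightarrow> 'g \<Rightarrow> 'k"
  where "right_diff h \<phi> = (\<lambda>x. \<phi> (x \<otimes>\<^bsub>G\<^esub> h) \<ominus>\<^bsub>K\<^esub> \<phi> x)"

text \<open>
  \<open>poly_fun n \<phi>\<close> says that \<open>\<phi>\<close> is a polynomial function of degree less than \<open>n\<close>. Counting with
  \<open>n\<close> instead of the degree gives the zero function the index \<open>0\<close> and makes the index match the
  power of the augmentation ideal that is annihilated.
\<close>

primrec poly_fun :: "nat \<Rightarrow> ('g \<Rightarrow> 'k) \<Rightarrow> bool"
  where
    "poly_fun 0 \<phi> \<longleftrightarrow> (\<forall>x \<in> carrier G. \<phi> x = \<zero>\<^bsub>K\<^esub>)"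
  | "poly_fun (Suc n) \<phi> \<longleftrightarrow>
       \<phi> \<in> carrier G \<rightarrow> carrier K \<and> (\<forall>h \<in> carrier G. poly_fun n (right_diff h \<phi>))"

lemma poly_fun_closed: "poly_fun n \<phi> \<Longrightarrow> x \<in> carrier G \<Longrightarrow> \<phi> x \<in> carrier K"
  by (cases n) auto

lemma right_diff_cong:
  "(\<And>x. x \<in> carrier G \<Longrightarrow> \<phi> x = \<psi> x) \<Longrightarrow> h \<in> carrier G \<Longrightarrow> x \<in> carrier G
     \<Longrightarrow> right_diff h \<phi> x = right_diff h \<psi> x"
  by (simp add: right_diff_def)

lemma poly_fun_cong:
  "(\<And>x. x \<in> carrier G \<Longrightarrow> \<phi> x = \<psi> x) \<Longrightarrow> poly_fun n \<phi> \<Longrightarrow> poly_fun n \<psi>"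
proof (induction n arbitrary: \<phi> \<psi>)
  case 0
  then show ?case by auto
next
  case (Suc n)
  have "poly_fun n (right_diff h \<psi>)" if "h \<in> carrier G" for h
    using Suc.IH[of "right_diff h \<phi>" "right_diff h \<psi>"] Suc.prems that
      right_diff_cong[of \<phi> \<psi> h] by auto
  moreover have "\<psi> \<in> carrier G \<rightarrow> carrier K"
    using Suc.prems poly_fun_closed[of "Suc n" \<phi>] by fastforce
  ultimately show ?case by auto
qed

lemma poly_fun_zero: "poly_fun n (\<lambda>x. \<zero>\<^bsub>K\<^esub>)"
  by (induction n) (auto simp: right_diff_def K.minus_eq)

lemma poly_fun_Suc: "poly_fun n \<phi> \<Longrightarrow> poly_fun (Suc n) \<phi>"
proof (induction n arbitrary: \<phi>)
  case 0
  then show ?case by (auto simp: right_diff_def K.minus_eq)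
next
  case (Suc n)
  then show ?case by (metis poly_fun.simps(2))
qed

lemma poly_fun_mono:
  assumes "poly_fun m \<phi>" "m \<le> n"
  shows "poly_fun n \<phi>"
  using assms(2,1) by (induction rule: dec_induct) (blast intro: poly_fun_Suc)+

lemma right_diff_poly_fun: "poly_fun n \<phi> \<Longrightarrow> h \<in> carrier G \<Longrightarrow> poly_fun n (right_diff h \<phi>)"
  by (metis poly_fun.simps(2) poly_fun_Suc)

lemma poly_fun_add:
  "poly_fun n \<phi> \<Longrightarrow> poly_fun n \<psi> \<Longrightarrow> poly_fun n (\<lambda>x. \<phi> x \<oplus>\<^bsub>K\<^esub> \<psi> x)"
proof (induction n arbitrary: \<phi> \<psi>)
  case 0
  then show ?case by auto
next
  case (Suc n)
  have "poly_fun n (right_diff h (\<lambda>x. \<phi> x \<oplus>\<^bsub>K\<^esub> \<psi> x))" if h: "h \<in> carrier G" for h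
  proof (rule poly_fun_cong)
    show "poly_fun n (\<lambda>x. right_diff h \<phi> x \<oplus>\<^bsub>K\<^esub> right_diff h \<psi> x)"
      using Suc h by auto
    fix x assume "x \<in> carrier G"
    then show "right_diff h \<phi> x \<oplus>\<^bsub>K\<^esub> right_diff h \<psi> x = right_diff h (\<lambda>x. \<phi> x \<oplus>\<^bsub>K\<^esub> \<psi> x) x"
      using poly_fun_closed[OF Suc.prems(1)] poly_fun_closed[OF Suc.prems(2)] h
      by (simp add: right_diff_def K.minus_eq K.minus_add K.a_ac)
  qed
  then show ?case
    using Suc.prems by (auto simp: Pi_iff)
qed

lemma poly_fun_const: "c \<in> carrier K \<Longrightarrow> poly_fun (Suc n) (\<lambda>x. c)"
  by (rule poly_fun_mono[of "Suc 0"]) (auto simp: right_diff_def K.minus_eq K.r_neg)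

text \<open>
  The product rule for differences has a quadratic third term. It does no harm to degrees, since
  both of its factors have dropped in degree.
\<close>

lemma right_diff_mult:
  assumes "\<phi> \<in> carrier G \<rightarrow> carrier K" "\<psi> \<in> carrier G \<rightarrow> carrier K" "h \<in> carrier G" "x \<in> carrier G"
  shows "right_diff h (\<lambda>x. \<phi> x \<otimes>\<^bsub>K\<^esub> \<psi> x) x =
    (right_diff h \<phi> x \<otimes>\<^bsub>K\<^esub> \<psi> x \<oplus>\<^bsub>K\<^esub> \<phi> x \<otimes>\<^bsub>K\<^esub> right_diff h \<psi> x)
      \<oplus>\<^bsub>K\<^esub> right_diff h \<phi> x \<otimes>\<^bsub>K\<^esub> right_diff h \<psi> x"
proof -
  define a b where "a = \<phi> x" and "b = \<psi> x"
  define a' b' where "a' = right_diff h \<phi> x" and "b' = right_diff h \<psi> x"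
  have c: "a \<in> carrier K" "b \<in> carrier K" "a' \<in> carrier K" "b' \<in> carrier K"
    using assms by (auto simp: a_def b_def a'_def b'_def right_diff_def)
  have "\<phi> (x \<otimes>\<^bsub>G\<^esub> h) = a \<oplus>\<^bsub>K\<^esub> a'" "\<psi> (x \<otimes>\<^bsub>G\<^esub> h) = b \<oplus>\<^bsub>K\<^esub> b'"
    using assms by (auto simp: a_def b_def a'_def b'_def right_diff_def K.minus_eq Pi_iff
        K.a_ac K.r_neg2)
  then have "right_diff h (\<lambda>x. \<phi> x \<otimes>\<^bsub>K\<^esub> \<psi> x) x = (a \<oplus>\<^bsub>K\<^esub> a') \<otimes>\<^bsub>K\<^esub> (b \<oplus>\<^bsub>K\<^esub> b') \<ominus>\<^bsub>K\<^esub> a \<otimes>\<^bsub>K\<^esub> b"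
    by (simp add: right_diff_def a_def b_def)
  also have "\<dots> = (a' \<otimes>\<^bsub>K\<^esub> b \<oplus>\<^bsub>K\<^esub> a \<otimes>\<^bsub>K\<^esub> b') \<oplus>\<^bsub>K\<^esub> a' \<otimes>\<^bsub>K\<^esub> b'"
    using c by (simp add: K.minus_eq K.l_distr K.r_distr K.a_ac K.r_neg2 K.r_neg1 K.r_neg)
  finally show ?thesis
    by (simp add: a_def b_def a'_def b'_def)
qed

text \<open>
  By the product rule, a difference of the product is a sum of three products, in each of which the
  degrees have a smaller sum.
\<close>

lemma poly_fun_mult:
  "poly_fun (Suc m) \<phi> \<Longrightarrow> poly_fun (Suc n) \<psi> \<Longrightarrow> poly_fun (Suc (m + n)) (\<lambda>x. \<phi> x \<otimes>\<^bsub>K\<^esub> \<psi> x)"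
proof (induction "m + n" arbitrary: m n \<phi> \<psi> rule: less_induct)
  case less
  have \<phi>: "\<phi> \<in> carrier G \<rightarrow> carrier K" and \<psi>: "\<psi> \<in> carrier G \<rightarrow> carrier K"
    using less.prems by auto
  have "poly_fun (m + n) (right_diff h (\<lambda>x. \<phi> x \<otimes>\<^bsub>K\<^esub> \<psi> x))" if h: "h \<in> carrier G" for h
  proof (rule poly_fun_cong[OF right_diff_mult[OF \<phi> \<psi> h, symmetric]])
    have d\<phi>: "poly_fun m (right_diff h \<phi>)" and d\<psi>: "poly_fun n (right_diff h \<psi>)"
      using less.prems h by auto
    have 1: "poly_fun (m + n) (\<lambda>x. right_diff h \<phi> x \<otimes>\<^bsub>K\<^esub> \<psi> x)"
    proof (cases m)
      case 0
      then have "poly_fun 0 (\<lambda>x. right_diff h \<phi> x \<otimes>\<^bsub>K\<^esub> \<psi> x)"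
        using d\<phi> \<psi> 0 by (auto simp: Pi_iff)
      then show ?thesis by (rule poly_fun_mono) simp
    next
      case (Suc m')
      then show ?thesis using less.hyps[of m' n] d\<phi> less.prems by auto
    qed
    have 2: "poly_fun (m + n) (\<lambda>x. \<phi> x \<otimes>\<^bsub>K\<^esub> right_diff h \<psi> x)"
    proof (cases n)
      case 0
      then have "poly_fun 0 (\<lambda>x. \<phi> x \<otimes>\<^bsub>K\<^esub> right_diff h \<psi> x)"
        using d\<psi> \<phi> 0 by (auto simp: Pi_iff)
      then show ?thesis by (rule poly_fun_mono) simp
    next
      case (Suc n')
      then show ?thesis using less.hyps[of m n'] d\<psi> less.prems by auto
    qed
    have 3: "poly_fun (m + n) (\<lambda>x. right_diff h \<phi> x \<otimes>\<^bsub>K\<^esub> right_diff h \<psi> x)"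
    proof (cases m)
      case 0
      then have "poly_fun 0 (\<lambda>x. right_diff h \<phi> x \<otimes>\<^bsub>K\<^esub> right_diff h \<psi> x)"
        using d\<phi> poly_fun_closed[OF d\<psi>] by auto
      then show ?thesis by (rule poly_fun_mono) simp
    next
      case (Suc m')
      then show ?thesis using less.hyps[of m' n] d\<phi> poly_fun_Suc[OF d\<psi>] by auto
    qed
    show "poly_fun (m + n) (\<lambda>x. (right_diff h \<phi> x \<otimes>\<^bsub>K\<^esub> \<psi> x \<oplus>\<^bsub>K\<^esub> \<phi> x \<otimes>\<^bsub>K\<^esub> right_diff h \<psi> x)
      \<oplus>\<^bsub>K\<^esub> right_diff h \<phi> x \<otimes>\<^bsub>K\<^esub> right_diff h \<psi> x)"
      by (intro poly_fun_add 1 2 3)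
  qed
  then show ?case
    using \<phi> \<psi> by (auto simp: Pi_iff)
qed

lemma poly_fun_smult:
  assumes "c \<in> carrier K" "poly_fun n \<phi>"
  shows "poly_fun n (\<lambda>x. c \<otimes>\<^bsub>K\<^esub> \<phi> x)"
proof (cases n)
  case 0
  then show ?thesis using assms by auto
next
  case (Suc m)
  then show ?thesis
    using poly_fun_mult[OF poly_fun_const[OF assms(1), of 0], of m \<phi>] assms by simp
qed

lemma poly_fun_diff:
  assumes "poly_fun n \<phi>" "poly_fun n \<psi>"
  shows "poly_fun n (\<lambda>x. \<phi> x \<ominus>\<^bsub>K\<^esub> \<psi> x)"
proof (rule poly_fun_cong)
  show "poly_fun n (\<lambda>x. \<phi> x \<oplus>\<^bsub>K\<^esub> (\<ominus>\<^bsub>K\<^esub> \<one>\<^bsub>K\<^esub>) \<otimes>\<^bsub>K\<^esub> \<psi> x)"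
    by (intro poly_fun_add poly_fun_smult assms) simp
qed (use poly_fun_closed[OF assms(2)] in \<open>simp add: K.minus_eq K.l_minus\<close>)

lemma poly_fun_finsum:
  assumes "finite I" "\<And>i. i \<in> I \<Longrightarrow> poly_fun n (\<phi> i)"
  shows "poly_fun n (\<lambda>x. \<Oplus>\<^bsub>K\<^esub>i\<in>I. \<phi> i x)"
  using assms
proof (induction I rule: finite_induct)
  case empty
  then show ?case by (simp add: poly_fun_zero)
next
  case (insert i I)
  have "poly_fun n (\<lambda>x. \<phi> i x \<oplus>\<^bsub>K\<^esub> (\<Oplus>\<^bsub>K\<^esub>i\<in>I. \<phi> i x))"
    by (rule poly_fun_add) (use insert in auto)
  then show ?case
    using poly_fun_closed[OF insert.prems] insert.hyps
    by (elim poly_fun_cong[rotated]) (simp add: Pi_iff K.finsum_insert)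
qed

lemma poly_fun_finprod:
  assumes "finite I" "\<And>i. i \<in> I \<Longrightarrow> poly_fun (Suc (w i)) (\<phi> i)"
  shows "poly_fun (Suc (sum w I)) (\<lambda>x. \<Otimes>\<^bsub>K\<^esub>i\<in>I. \<phi> i x)"
  using assms
proof (induction I rule: finite_induct)
  case empty
  have "poly_fun (Suc 0) (\<lambda>x. \<one>\<^bsub>K\<^esub>)" by (rule poly_fun_const) simp
  then show ?case by simp
next
  case (insert i I)
  have "poly_fun (Suc (w i + sum w I)) (\<lambda>x. \<phi> i x \<otimes>\<^bsub>K\<^esub> (\<Otimes>\<^bsub>K\<^esub>i\<in>I. \<phi> i x))"
    by (rule poly_fun_mult) (use insert in auto)
  then show ?case
    using poly_fun_closed[OF insert.prems] insert.hyps
    by (simp add: Pi_iff del: poly_fun.simps, elim poly_fun_cong[rotated])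
       (simp add: Pi_iff K.finprod_insert)
qed

text \<open>
  The definition uses right differences only, but left differences commute with them, so they lower
  the degree as well. This makes polynomial functions stable under translations on both sides.
\<close>

lemma left_diff_poly_fun:
  "poly_fun (Suc n) \<phi> \<Longrightarrow> u \<in> carrier G \<Longrightarrow> poly_fun n (\<lambda>x. \<phi> (u \<otimes>\<^bsub>G\<^esub> x) \<ominus>\<^bsub>K\<^esub> \<phi> x)"
proof (induction n arbitrary: \<phi>)
  case 0
  have const: "\<phi> x = \<phi> \<one>\<^bsub>G\<^esub>" if "x \<in> carrier G" for x
  proof -
    have "right_diff x \<phi> \<one>\<^bsub>G\<^esub> = \<zero>\<^bsub>K\<^esub>" using 0 that by simp
    then show ?thesis
      using that poly_fun_closed[OF 0(1)] by (simp add: right_diff_def K.r_right_minus_eq)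
  qed
  have "\<phi> (u \<otimes>\<^bsub>G\<^esub> x) = \<phi> x" if "x \<in> carrier G" for x
    using const[of x] const[of "u \<otimes>\<^bsub>G\<^esub> x"] that 0(2) by simp
  then show ?case
    using poly_fun_closed[OF 0(1)] by (simp add: K.r_right_minus_eq)
next
  case (Suc n)
  have "poly_fun n (right_diff h (\<lambda>x. \<phi> (u \<otimes>\<^bsub>G\<^esub> x) \<ominus>\<^bsub>K\<^esub> \<phi> x))" if h: "h \<in> carrier G" for h
  proof (rule poly_fun_cong)
    show "poly_fun n (\<lambda>x. right_diff h \<phi> (u \<otimes>\<^bsub>G\<^esub> x) \<ominus>\<^bsub>K\<^esub> right_diff h \<phi> x)"
      using Suc.IH[of "right_diff h \<phi>"] Suc.prems h by (metis poly_fun.simps(2))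
    fix x assume "x \<in> carrier G"
    then show "right_diff h \<phi> (u \<otimes>\<^bsub>G\<^esub> x) \<ominus>\<^bsub>K\<^esub> right_diff h \<phi> x
        = right_diff h (\<lambda>x. \<phi> (u \<otimes>\<^bsub>G\<^esub> x) \<ominus>\<^bsub>K\<^esub> \<phi> x) x"
      using h Suc.prems poly_fun_closed[OF Suc.prems(1)]
      by (simp add: right_diff_def K.minus_eq K.minus_add K.a_ac G.m_assoc)
  qed
  then show ?case
    using Suc.prems by (auto simp: Pi_iff)
qed

lemma poly_fun_left_translate:
  assumes "poly_fun n \<phi>" "u \<in> carrier G"
  shows "poly_fun n (\<lambda>x. \<phi> (u \<otimes>\<^bsub>G\<^esub> x))"
proof (rule poly_fun_cong)
  show "poly_fun n (\<lambda>x. (\<phi> (u \<otimes>\<^bsub>G\<^esub> x) \<ominus>\<^bsub>K\<^esub> \<phi> x) \<oplus>\<^bsub>K\<^esub> \<phi> x)"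
    using left_diff_poly_fun[OF poly_fun_Suc] assms by (intro poly_fun_add) auto
qed (use assms poly_fun_closed[OF assms(1)] in \<open>simp add: K.minus_eq K.a_ac K.r_neg2\<close>)

lemma poly_fun_right_translate:
  assumes "poly_fun n \<phi>" "u \<in> carrier G"
  shows "poly_fun n (\<lambda>x. \<phi> (x \<otimes>\<^bsub>G\<^esub> u))"
proof (rule poly_fun_cong)
  show "poly_fun n (\<lambda>x. right_diff u \<phi> x \<oplus>\<^bsub>K\<^esub> \<phi> x)"
    using right_diff_poly_fun assms by (intro poly_fun_add) auto
qed (use assms poly_fun_closed[OF assms(1)] in \<open>simp add: right_diff_def K.minus_eq K.a_ac K.r_neg2\<close>)

end

section \<open>Polynomial functions are determined by their values on balls\<close>

context field_and_group
begin

lemma word_product_closed: "set w \<subseteq> carrier G \<Longrightarrow> word_product G w \<in> carrier G"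
  by (induction w) (auto simp: word_product_def)

lemma word_product_snoc:
  "set w \<subseteq> carrier G \<Longrightarrow> s \<in> carrier G \<Longrightarrow>
     word_product G (w @ [s]) = word_product G w \<otimes>\<^bsub>G\<^esub> s"
  using word_product_closed by (induction w) (auto simp: word_product_def G.m_assoc)

text \<open>
  For a generator \<open>s\<close>, the difference of \<open>\<phi>\<close> along \<open>s\<close> has smaller degree and vanishes on all words
  of length less than \<open>n - 1\<close>, hence everywhere by induction. So \<open>\<phi>\<close> is invariant under right
  multiplication by generators, and it vanishes at the empty word.
\<close>

lemma poly_fun_eq_zero:
  assumes S: "generates_as_semigroup G S"
  shows "poly_fun n \<phi> \<Longrightarrow> (\<And>w. set w \<subseteq> S \<Longrightarrow> length w < n \<Longrightarrow> \<phi> (word_product G w) = \<zero>\<^bsub>K\<^esub>)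
     \<Longrightarrow> x \<in> carrier G \<Longrightarrow> \<phi> x = \<zero>\<^bsub>K\<^esub>"
proof (induction n arbitrary: \<phi> x)
  case 0
  then show ?case by simp
next
  case (Suc n)
  have SG: "S \<subseteq> carrier G" using S by (simp add: generates_as_semigroup_def)
  have inv: "\<phi> (y \<otimes>\<^bsub>G\<^esub> s) = \<phi> y" if s: "s \<in> S" and y: "y \<in> carrier G" for s y
  proof -
    have sG: "s \<in> carrier G" using s SG by auto
    have "right_diff s \<phi> y = \<zero>\<^bsub>K\<^esub>"
    proof (rule Suc.IH[OF _ _ y])
      show "poly_fun n (right_diff s \<phi>)" using Suc.prems sG by auto
      fix w assume w: "set w \<subseteq> S" "length w < n"
      then have "\<phi> (word_product G w) = \<zero>\<^bsub>K\<^esub>" "\<phi> (word_product G (w @ [s])) = \<zero>\<^bsub>K\<^esub>"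
        using Suc.prems(2)[of w] Suc.prems(2)[of "w @ [s]"] s by auto
      then show "right_diff s \<phi> (word_product G w) = \<zero>\<^bsub>K\<^esub>"
        using w SG sG word_product_snoc[of w s] by (auto simp: right_diff_def K.minus_eq)
    qed
    then show ?thesis
      using y sG poly_fun_closed[OF Suc.prems(1)] by (simp add: right_diff_def K.r_right_minus_eq)
  qed
  have "\<phi> (word_product G w) = \<zero>\<^bsub>K\<^esub>" if "set w \<subseteq> S" for w
    using that
  proof (induction w rule: rev_induct)
    case Nil
    then show ?case using Suc.prems(2)[of "[]"] by simp
  next
    case (snoc s w)
    then show ?case
      using SG inv[of s "word_product G w"] word_product_snoc[of w s] word_product_closed[of w]
      by fastforce
  qed
  moreover obtain w where "set w \<subseteq> S" "x = word_product G w"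
    using S Suc.prems(3) by (auto simp: generates_as_semigroup_def)
  ultimately show ?case by simp
qed

end

section \<open>Separating a vector from a subspace\<close>

text \<open>
  The functional comes from a subspace that is maximal among those
  containing \<open>W\<close> but not \<open>v\<close>; such a subspace is a complement of the line through \<open>v\<close>, and the
  functional is the coordinate along \<open>v\<close>.
\<close>

lemma (in vectorspace) separating_functional:
  assumes W0: "\<zero>\<^bsub>V\<^esub> \<in> W" and WV: "W \<subseteq> carrier V"
    and Wadd: "\<And>x y. x \<in> W \<Longrightarrow> y \<in> W \<Longrightarrow> x \<oplus>\<^bsub>V\<^esub> y \<in> W"
    and Wsm: "\<And>c x. c \<in> carrier K \<Longrightarrow> x \<in> W \<Longrightarrow> c \<odot>\<^bsub>V\<^esub> x \<in> W"
    and v: "v \<in> carrier V" "v \<notin> W"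
  obtains F where "F \<in> carrier V \<rightarrow> carrier K"
    and "\<And>x y. x \<in> carrier V \<Longrightarrow> y \<in> carrier V \<Longrightarrow> F (x \<oplus>\<^bsub>V\<^esub> y) = F x \<oplus>\<^bsub>K\<^esub> F y"
    and "\<And>c x. c \<in> carrier K \<Longrightarrow> x \<in> carrier V \<Longrightarrow> F (c \<odot>\<^bsub>V\<^esub> x) = c \<otimes>\<^bsub>K\<^esub> F x"
    and "\<And>x. x \<in> W \<Longrightarrow> F x = \<zero>\<^bsub>K\<^esub>"
    and "F v = \<one>\<^bsub>K\<^esub>"
proof -
  define \<A> where "\<A> = {U. W \<subseteq> U \<and> U \<subseteq> carrier V \<and> v \<notin> U \<and>
      (\<forall>x\<in>U. \<forall>y\<in>U. x \<oplus>\<^bsub>V\<^esub> y \<in> U) \<and> (\<forall>c\<in>carrier K. \<forall>x\<in>U. c \<odot>\<^bsub>V\<^esub> x \<in> U)}"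
  have "\<exists>M\<in>\<A>. \<forall>Z\<in>\<A>. M \<subseteq> Z \<longrightarrow> Z = M"
  proof (rule subset_Zorn_nonempty)
    have "W \<in> \<A>" using assms by (auto simp: \<A>_def)
    then show "\<A> \<noteq> {}" by auto
    fix \<C> assume ne: "\<C> \<noteq> {}" and ch: "subset.chain \<A> \<C>"
    have sub: "\<C> \<subseteq> \<A>" using ch by (auto simp: subset.chain_def)
    have "x \<oplus>\<^bsub>V\<^esub> y \<in> \<Union>\<C>" if xy: "x \<in> \<Union>\<C>" "y \<in> \<Union>\<C>" for x y
    proof -
      obtain Z Y where ZY: "Z \<in> \<C>" "Y \<in> \<C>" "x \<in> Z" "y \<in> Y" using xy by blast
      then have "Z \<subseteq> Y \<or> Y \<subseteq> Z" using ch by (auto simp: subset.chain_def)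
      then obtain Q where "Q \<in> \<C>" "x \<in> Q" "y \<in> Q" using ZY by blast
      then show ?thesis using sub by (auto simp: \<A>_def)
    qed
    moreover have "c \<odot>\<^bsub>V\<^esub> x \<in> \<Union>\<C>" if "c \<in> carrier K" "x \<in> \<Union>\<C>" for c x
      using that sub by (fastforce simp: \<A>_def)
    moreover have "W \<subseteq> \<Union>\<C>" "\<Union>\<C> \<subseteq> carrier V" "v \<notin> \<Union>\<C>"
      using ne sub by (fastforce simp: \<A>_def)+
    ultimately show "\<Union>\<C> \<in> \<A>"
      unfolding \<A>_def by blast
  qed
  then obtain M where M: "M \<in> \<A>" and max: "\<And>Z. Z \<in> \<A> \<Longrightarrow> M \<subseteq> Z \<Longrightarrow> Z = M" by blast
  have MV: "M \<subseteq> carrier V" and vM: "v \<notin> M" and WM: "W \<subseteq> M"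
    and Madd: "\<And>x y. x \<in> M \<Longrightarrow> y \<in> M \<Longrightarrow> x \<oplus>\<^bsub>V\<^esub> y \<in> M"
    and Msm: "\<And>c x. c \<in> carrier K \<Longrightarrow> x \<in> M \<Longrightarrow> c \<odot>\<^bsub>V\<^esub> x \<in> M"
    using M by (auto simp: \<A>_def)
  have M0: "\<zero>\<^bsub>V\<^esub> \<in> M" using W0 WM by auto
  have MVx: "x \<in> carrier V" if "x \<in> M" for x using MV that by auto
  have Mneg: "\<ominus>\<^bsub>V\<^esub> x \<in> M" if "x \<in> M" for x
    using Msm[of "\<ominus>\<^bsub>K\<^esub> \<one>\<^bsub>K\<^esub>" x] that MVx by (simp add: smult_l_minus)
  have inv: "inv\<^bsub>K\<^esub> c \<in> carrier K" "inv\<^bsub>K\<^esub> c \<otimes>\<^bsub>K\<^esub> c = \<one>\<^bsub>K\<^esub>"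
    if "c \<in> carrier K" "c \<noteq> \<zero>\<^bsub>K\<^esub>" for c
    using that field_Units Units_inv_closed Units_l_inv by auto
  have scaled: "c \<odot>\<^bsub>V\<^esub> v \<in> M \<Longrightarrow> c = \<zero>\<^bsub>K\<^esub>" if "c \<in> carrier K" for c
  proof (rule ccontr)
    assume "c \<odot>\<^bsub>V\<^esub> v \<in> M" "c \<noteq> \<zero>\<^bsub>K\<^esub>"
    then have "inv\<^bsub>K\<^esub> c \<odot>\<^bsub>V\<^esub> (c \<odot>\<^bsub>V\<^esub> v) \<in> M" using inv that Msm by blast
    then show False
      using that inv[of c] \<open>c \<noteq> \<zero>\<^bsub>K\<^esub>\<close> v vM by (simp add: smult_assoc1[symmetric])
  qed
  \<comment> \<open>If \<open>M + K x\<close> avoids \<open>v\<close>, maximality puts \<open>x\<close> into \<open>M\<close>; otherwise an equation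
    \<open>v = m + a x\<close> with \<open>a \<noteq> 0\<close> can be solved for \<open>x\<close>.\<close>
  have ex: "\<exists>c\<in>carrier K. \<exists>m\<in>M. x = m \<oplus>\<^bsub>V\<^esub> c \<odot>\<^bsub>V\<^esub> v" if x: "x \<in> carrier V" for x
  proof -
    define Z where "Z = {m \<oplus>\<^bsub>V\<^esub> a \<odot>\<^bsub>V\<^esub> x | m a. m \<in> M \<and> a \<in> carrier K}"
    have MZ: "M \<subseteq> Z"
    proof
      fix m assume "m \<in> M"
      then have "m = m \<oplus>\<^bsub>V\<^esub> \<zero>\<^bsub>K\<^esub> \<odot>\<^bsub>V\<^esub> x" using x MVx by simp
      then show "m \<in> Z" using \<open>m \<in> M\<close> unfolding Z_def by blast
    qed
    have xX: "x \<in> Z"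
    proof -
      have "x = \<zero>\<^bsub>V\<^esub> \<oplus>\<^bsub>V\<^esub> \<one>\<^bsub>K\<^esub> \<odot>\<^bsub>V\<^esub> x" using x by simp
      then show ?thesis using M0 unfolding Z_def by blast
    qed
    have Xadd: "p \<oplus>\<^bsub>V\<^esub> q \<in> Z" if pq: "p \<in> Z" "q \<in> Z" for p q
    proof -
      obtain m a n b where *: "p = m \<oplus>\<^bsub>V\<^esub> a \<odot>\<^bsub>V\<^esub> x" "q = n \<oplus>\<^bsub>V\<^esub> b \<odot>\<^bsub>V\<^esub> x"
        "m \<in> M" "n \<in> M" "a \<in> carrier K" "b \<in> carrier K" using pq by (auto simp: Z_def)
      then have "p \<oplus>\<^bsub>V\<^esub> q = (m \<oplus>\<^bsub>V\<^esub> n) \<oplus>\<^bsub>V\<^esub> (a \<oplus>\<^bsub>K\<^esub> b) \<odot>\<^bsub>V\<^esub> x"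
        using x MVx by (simp add: smult_l_distr M.a_ac)
      then show ?thesis using * Madd unfolding Z_def by blast
    qed
    have Xsm: "c \<odot>\<^bsub>V\<^esub> p \<in> Z" if cp: "c \<in> carrier K" "p \<in> Z" for c p
    proof -
      obtain m a where *: "p = m \<oplus>\<^bsub>V\<^esub> a \<odot>\<^bsub>V\<^esub> x" "m \<in> M" "a \<in> carrier K"
        using cp by (auto simp: Z_def)
      then have "c \<odot>\<^bsub>V\<^esub> p = c \<odot>\<^bsub>V\<^esub> m \<oplus>\<^bsub>V\<^esub> (c \<otimes>\<^bsub>K\<^esub> a) \<odot>\<^bsub>V\<^esub> x"
        using x MVx cp by (simp add: smult_r_distr smult_assoc1)
      then show ?thesis using * cp Msm unfolding Z_def by blast
    qed
    have XV: "Z \<subseteq> carrier V" using x MVx by (auto simp: Z_def)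
    show ?thesis
    proof (cases "v \<in> Z")
      case False
      then have "Z \<in> \<A>" using Xadd Xsm XV MZ WM by (auto simp: \<A>_def)
      then have "x \<in> M" using max MZ xX by blast
      moreover have "x = x \<oplus>\<^bsub>V\<^esub> \<zero>\<^bsub>K\<^esub> \<odot>\<^bsub>V\<^esub> v" using x v by simp
      ultimately show ?thesis by blast
    next
      case True
      then obtain m a where *: "v = m \<oplus>\<^bsub>V\<^esub> a \<odot>\<^bsub>V\<^esub> x" "m \<in> M" "a \<in> carrier K"
        by (auto simp: Z_def)
      have a0: "a \<noteq> \<zero>\<^bsub>K\<^esub>" using * vM x MVx by auto
      have "inv\<^bsub>K\<^esub> a \<odot>\<^bsub>V\<^esub> v = inv\<^bsub>K\<^esub> a \<odot>\<^bsub>V\<^esub> m \<oplus>\<^bsub>V\<^esub> inv\<^bsub>K\<^esub> a \<odot>\<^bsub>V\<^esub> (a \<odot>\<^bsub>V\<^esub> x)"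
        using * inv[OF *(3) a0] x MVx by (simp add: smult_r_distr)
      also have "inv\<^bsub>K\<^esub> a \<odot>\<^bsub>V\<^esub> (a \<odot>\<^bsub>V\<^esub> x) = x"
        using * inv[OF *(3) a0] x by (simp add: smult_assoc1[symmetric])
      finally have "x = \<ominus>\<^bsub>V\<^esub> (inv\<^bsub>K\<^esub> a \<odot>\<^bsub>V\<^esub> m) \<oplus>\<^bsub>V\<^esub> inv\<^bsub>K\<^esub> a \<odot>\<^bsub>V\<^esub> v"
        using x * MVx inv[OF *(3) a0] by (simp add: M.r_neg1)
      moreover have "\<ominus>\<^bsub>V\<^esub> (inv\<^bsub>K\<^esub> a \<odot>\<^bsub>V\<^esub> m) \<in> M" using Mneg Msm inv[OF *(3) a0] * by blast
      ultimately show ?thesis using inv[OF *(3) a0] by blast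
    qed
  qed
  have uniq: "c = c'" if "c \<in> carrier K" "c' \<in> carrier K" "m \<in> M" "m' \<in> M"
      "m \<oplus>\<^bsub>V\<^esub> c \<odot>\<^bsub>V\<^esub> v = m' \<oplus>\<^bsub>V\<^esub> c' \<odot>\<^bsub>V\<^esub> v" for c c' m m'
  proof -
    have "c \<odot>\<^bsub>V\<^esub> v = \<ominus>\<^bsub>V\<^esub> m \<oplus>\<^bsub>V\<^esub> (m \<oplus>\<^bsub>V\<^esub> c \<odot>\<^bsub>V\<^esub> v)"
      using that v MVx by (intro M.r_neg1[symmetric]) auto
    also have "\<dots> = (\<ominus>\<^bsub>V\<^esub> m \<oplus>\<^bsub>V\<^esub> m') \<oplus>\<^bsub>V\<^esub> c' \<odot>\<^bsub>V\<^esub> v"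
      using that v MVx by (simp add: M.a_assoc)
    finally have "(c \<ominus>\<^bsub>K\<^esub> c') \<odot>\<^bsub>V\<^esub> v = \<ominus>\<^bsub>V\<^esub> m \<oplus>\<^bsub>V\<^esub> m'"
      using that v MVx
      by (simp add: R.minus_eq smult_l_distr smult_l_minus M.a_assoc M.r_neg)
    then have "(c \<ominus>\<^bsub>K\<^esub> c') \<odot>\<^bsub>V\<^esub> v \<in> M" using Madd Mneg that by simp
    then show ?thesis using scaled[of "c \<ominus>\<^bsub>K\<^esub> c'"] that by simp
  qed
  define F where "F x = (SOME c. c \<in> carrier K \<and> (\<exists>m\<in>M. x = m \<oplus>\<^bsub>V\<^esub> c \<odot>\<^bsub>V\<^esub> v))" for x
  have F: "F x \<in> carrier K \<and> (\<exists>m\<in>M. x = m \<oplus>\<^bsub>V\<^esub> F x \<odot>\<^bsub>V\<^esub> v)" if "x \<in> carrier V" for x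
    unfolding F_def by (rule someI_ex) (use ex[OF that] in blast)
  have Feq: "F x = c" if "c \<in> carrier K" "m \<in> M" "x = m \<oplus>\<^bsub>V\<^esub> c \<odot>\<^bsub>V\<^esub> v" for x c m
  proof -
    have "x \<in> carrier V" using that v MVx by simp
    then show ?thesis using F uniq that by metis
  qed
  show ?thesis
  proof (rule that)
    show "F \<in> carrier V \<rightarrow> carrier K" using F by blast
    show "F (x \<oplus>\<^bsub>V\<^esub> y) = F x \<oplus>\<^bsub>K\<^esub> F y" if xy: "x \<in> carrier V" "y \<in> carrier V" for x y
    proof -
      obtain m n where *: "m \<in> M" "x = m \<oplus>\<^bsub>V\<^esub> F x \<odot>\<^bsub>V\<^esub> v" "n \<in> M" "y = n \<oplus>\<^bsub>V\<^esub> F y \<odot>\<^bsub>V\<^esub> v"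
        using F xy by blast
      have c: "F x \<in> carrier K" "F y \<in> carrier K" using F xy by auto
      have "x \<oplus>\<^bsub>V\<^esub> y = (m \<oplus>\<^bsub>V\<^esub> F x \<odot>\<^bsub>V\<^esub> v) \<oplus>\<^bsub>V\<^esub> (n \<oplus>\<^bsub>V\<^esub> F y \<odot>\<^bsub>V\<^esub> v)" using * by simp
      also have "\<dots> = (m \<oplus>\<^bsub>V\<^esub> n) \<oplus>\<^bsub>V\<^esub> (F x \<oplus>\<^bsub>K\<^esub> F y) \<odot>\<^bsub>V\<^esub> v"
        using c *(1,3) v MVx by (simp add: smult_l_distr M.a_ac)
      finally show ?thesis using c Madd *(1,3) by (intro Feq[of _ "m \<oplus>\<^bsub>V\<^esub> n"]) auto
    qed
    show "F (c \<odot>\<^bsub>V\<^esub> x) = c \<otimes>\<^bsub>K\<^esub> F x" if cx: "c \<in> carrier K" "x \<in> carrier V" for c x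
    proof -
      obtain m where *: "m \<in> M" "x = m \<oplus>\<^bsub>V\<^esub> F x \<odot>\<^bsub>V\<^esub> v" using F cx by blast
      have Fx: "F x \<in> carrier K" using F cx by auto
      have "c \<odot>\<^bsub>V\<^esub> x = c \<odot>\<^bsub>V\<^esub> (m \<oplus>\<^bsub>V\<^esub> F x \<odot>\<^bsub>V\<^esub> v)" using * by simp
      also have "\<dots> = c \<odot>\<^bsub>V\<^esub> m \<oplus>\<^bsub>V\<^esub> (c \<otimes>\<^bsub>K\<^esub> F x) \<odot>\<^bsub>V\<^esub> v"
        using cx Fx *(1) v MVx by (simp add: smult_r_distr smult_assoc1)
      finally show ?thesis using cx Fx Msm *(1) by (intro Feq[of _ "c \<odot>\<^bsub>V\<^esub> m"]) auto
    qed
    show "F x = \<zero>\<^bsub>K\<^esub>" if "x \<in> W" for x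
      using that WM MVx v by (intro Feq[of _ x]) auto
    show "F v = \<one>\<^bsub>K\<^esub>"
      using M0 v by (intro Feq[of _ "\<zero>\<^bsub>V\<^esub>"]) auto
  qed
qed

section \<open>The group algebra and its linear functionals\<close>

context field_and_group
begin

abbreviation KG where "KG \<equiv> group_algebra K G"

abbreviation supp :: "('g \<Rightarrow> 'k) \<Rightarrow> 'g set"
  where "supp f \<equiv> {x. f x \<noteq> \<zero>\<^bsub>K\<^esub>}"

lemma KG_carrier:
  "f \<in> carrier KG \<longleftrightarrow> (\<forall>x. f x \<in> carrier K) \<and> supp f \<subseteq> carrier G \<and> finite (supp f)"
  by (auto simp: group_algebra_def)

lemma KG_simps [simp]:
  "\<zero>\<^bsub>KG\<^esub> = (\<lambda>x. \<zero>\<^bsub>K\<^esub>)"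
  "\<one>\<^bsub>KG\<^esub> = group_algebra_of K \<one>\<^bsub>G\<^esub>"
  "f \<oplus>\<^bsub>KG\<^esub> h = (\<lambda>x. f x \<oplus>\<^bsub>K\<^esub> h x)"
  "c \<odot>\<^bsub>KG\<^esub> f = (\<lambda>x. c \<otimes>\<^bsub>K\<^esub> f x)"
  by (auto simp: group_algebra_def group_algebra_of_def)

lemma KG_add_closed: "f \<in> carrier KG \<Longrightarrow> h \<in> carrier KG \<Longrightarrow> f \<oplus>\<^bsub>KG\<^esub> h \<in> carrier KG"
proof -
  assume f: "f \<in> carrier KG" and h: "h \<in> carrier KG"
  have "supp (\<lambda>x. f x \<oplus>\<^bsub>K\<^esub> h x) \<subseteq> supp f \<union> supp h" by auto
  then show ?thesis
    using f h finite_subset[of "supp (\<lambda>x. f x \<oplus>\<^bsub>K\<^esub> h x)" "supp f \<union> supp h"]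
    unfolding KG_carrier by auto
qed

lemma KG_smult_closed: "c \<in> carrier K \<Longrightarrow> f \<in> carrier KG \<Longrightarrow> c \<odot>\<^bsub>KG\<^esub> f \<in> carrier KG"
proof -
  assume c: "c \<in> carrier K" and f: "f \<in> carrier KG"
  have "supp (\<lambda>x. c \<otimes>\<^bsub>K\<^esub> f x) \<subseteq> supp f" using c by auto
  then show ?thesis
    using c f finite_subset[of "supp (\<lambda>x. c \<otimes>\<^bsub>K\<^esub> f x)" "supp f"]
    unfolding KG_carrier by auto
qed

lemma KG_zero_closed: "(\<lambda>x. \<zero>\<^bsub>K\<^esub>) \<in> carrier KG"
  by (auto simp: KG_carrier)

lemma KG_vectorspace: "vectorspace K KG"
proof -
  have "abelian_group KG"
  proof (rule abelian_groupI)
    fix f assume f: "f \<in> carrier KG"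
    have "(\<ominus>\<^bsub>K\<^esub> \<one>\<^bsub>K\<^esub>) \<odot>\<^bsub>KG\<^esub> f \<in> carrier KG" using f by (intro KG_smult_closed) auto
    moreover have "(\<ominus>\<^bsub>K\<^esub> \<one>\<^bsub>K\<^esub>) \<odot>\<^bsub>KG\<^esub> f \<oplus>\<^bsub>KG\<^esub> f = \<zero>\<^bsub>KG\<^esub>"
      using f by (auto simp: KG_carrier K.l_minus K.l_neg)
    ultimately show "\<exists>h\<in>carrier KG. h \<oplus>\<^bsub>KG\<^esub> f = \<zero>\<^bsub>KG\<^esub>" by blast
  qed (simp_all add: KG_add_closed[simplified] KG_zero_closed, auto simp: KG_carrier K.a_ac)
  then have "module K KG"
    by (intro moduleI K.cring_axioms)
      (auto simp: KG_smult_closed[simplified], auto simp: KG_carrier K.l_distr K.r_distr K.m_assoc)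
  then show ?thesis
    by (simp add: vectorspace_def K.field_axioms)
qed

lemma KG_minus:
  assumes "f \<in> carrier KG" "h \<in> carrier KG"
  shows "f \<ominus>\<^bsub>KG\<^esub> h = f \<oplus>\<^bsub>KG\<^esub> (\<ominus>\<^bsub>K\<^esub> \<one>\<^bsub>K\<^esub>) \<odot>\<^bsub>KG\<^esub> h"
proof -
  interpret V: vectorspace K KG by (rule KG_vectorspace)
  show ?thesis
    using assms by (simp add: V.M.minus_eq V.smult_l_minus del: KG_simps)
qed

lemma group_algebra_of_closed: "g \<in> carrier G \<Longrightarrow> group_algebra_of K g \<in> carrier KG"
  by (auto simp: KG_carrier group_algebra_of_def)

text \<open>
  The linear extension of a function on \<open>G\<close> to the group algebra.
\<close>

definition pairing :: "('g \<Rightarrow> 'k) \<Rightarrow> ('g \<Rightarrow> 'k) \<Rightarrow> 'k"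
  where "pairing \<phi> f = (\<Oplus>\<^bsub>K\<^esub>x \<in> supp f. f x \<otimes>\<^bsub>K\<^esub> \<phi> x)"

lemma pairing_superset:
  assumes "\<phi> \<in> carrier G \<rightarrow> carrier K" "\<And>x. x \<in> S \<Longrightarrow> f x \<in> carrier K"
    and "finite S" "S \<subseteq> carrier G" "supp f \<subseteq> S"
  shows "pairing \<phi> f = (\<Oplus>\<^bsub>K\<^esub>x \<in> S. f x \<otimes>\<^bsub>K\<^esub> \<phi> x)"
  unfolding pairing_def
proof (rule K.add.finprod_mono_neutral_cong_left)
  show "finite S" "supp f \<subseteq> S" by fact+
qed (use assms in \<open>auto simp: Pi_iff subset_iff\<close>)

lemma pairing_closed:
  "\<phi> \<in> carrier G \<rightarrow> carrier K \<Longrightarrow> f \<in> carrier KG \<Longrightarrow> pairing \<phi> f \<in> carrier K"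
  unfolding pairing_def by (intro K.finsum_closed) (auto simp: KG_carrier)

lemma pairing_add:
  assumes "\<phi> \<in> carrier G \<rightarrow> carrier K" "f \<in> carrier KG" "h \<in> carrier KG"
  shows "pairing \<phi> (f \<oplus>\<^bsub>KG\<^esub> h) = pairing \<phi> f \<oplus>\<^bsub>K\<^esub> pairing \<phi> h"
proof -
  define S where "S = supp f \<union> supp h"
  have S: "finite S" "S \<subseteq> carrier G" and c: "f x \<in> carrier K" "h x \<in> carrier K" for x
    using assms by (auto simp: S_def KG_carrier)
  have "pairing \<phi> (f \<oplus>\<^bsub>KG\<^esub> h) = (\<Oplus>\<^bsub>K\<^esub>x \<in> S. (f x \<oplus>\<^bsub>K\<^esub> h x) \<otimes>\<^bsub>K\<^esub> \<phi> x)"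
    using assms S c by (subst pairing_superset[of _ S]) (auto simp: S_def)
  also have "\<dots> = (\<Oplus>\<^bsub>K\<^esub>x \<in> S. f x \<otimes>\<^bsub>K\<^esub> \<phi> x \<oplus>\<^bsub>K\<^esub> h x \<otimes>\<^bsub>K\<^esub> \<phi> x)"
    using assms S c by (intro K.finsum_cong') (auto simp: K.l_distr Pi_iff subset_iff)
  also have "\<dots> = (\<Oplus>\<^bsub>K\<^esub>x \<in> S. f x \<otimes>\<^bsub>K\<^esub> \<phi> x) \<oplus>\<^bsub>K\<^esub> (\<Oplus>\<^bsub>K\<^esub>x \<in> S. h x \<otimes>\<^bsub>K\<^esub> \<phi> x)"
    using assms S c by (intro K.finsum_addf) (auto simp: Pi_iff subset_iff)
  also have "\<dots> = pairing \<phi> f \<oplus>\<^bsub>K\<^esub> pairing \<phi> h"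
    using assms S c by (simp add: pairing_superset[of _ S] S_def)
  finally show ?thesis .
qed

lemma pairing_smult:
  assumes "\<phi> \<in> carrier G \<rightarrow> carrier K" "f \<in> carrier KG" "c \<in> carrier K"
  shows "pairing \<phi> (c \<odot>\<^bsub>KG\<^esub> f) = c \<otimes>\<^bsub>K\<^esub> pairing \<phi> f"
proof -
  have S: "finite (supp f)" "supp f \<subseteq> carrier G" and c: "f x \<in> carrier K" for x
    using assms by (auto simp: KG_carrier)
  have "pairing \<phi> (c \<odot>\<^bsub>KG\<^esub> f) = (\<Oplus>\<^bsub>K\<^esub>x \<in> supp f. (c \<otimes>\<^bsub>K\<^esub> f x) \<otimes>\<^bsub>K\<^esub> \<phi> x)"
    using assms S c by (subst pairing_superset[of _ "supp f"]) auto
  also have "\<dots> = (\<Oplus>\<^bsub>K\<^esub>x \<in> supp f. c \<otimes>\<^bsub>K\<^esub> (f x \<otimes>\<^bsub>K\<^esub> \<phi> x))"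
    using assms S c by (intro K.finsum_cong') (auto simp: K.m_assoc Pi_iff subset_iff)
  also have "\<dots> = c \<otimes>\<^bsub>K\<^esub> pairing \<phi> f"
    unfolding pairing_def
    using assms S c by (intro K.finsum_rdistr[symmetric]) (auto simp: Pi_iff subset_iff)
  finally show ?thesis .
qed

lemma pairing_of:
  assumes "\<phi> \<in> carrier G \<rightarrow> carrier K" "g \<in> carrier G"
  shows "pairing \<phi> (group_algebra_of K g) = \<phi> g"
proof -
  have "pairing \<phi> (group_algebra_of K g) = (\<Oplus>\<^bsub>K\<^esub>x \<in> {g}. group_algebra_of K g x \<otimes>\<^bsub>K\<^esub> \<phi> x)"
    using assms by (intro pairing_superset) (auto simp: group_algebra_of_def)
  also have "\<dots> = \<phi> g" using assms by (simp add: group_algebra_of_def Pi_iff)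
  finally show ?thesis .
qed

lemma pairing_minus_one:
  assumes "\<phi> \<in> carrier G \<rightarrow> carrier K" "g \<in> carrier G"
  shows "pairing \<phi> (group_algebra_of K g \<ominus>\<^bsub>KG\<^esub> \<one>\<^bsub>KG\<^esub>) = \<phi> g \<ominus>\<^bsub>K\<^esub> \<phi> \<one>\<^bsub>G\<^esub>"
proof -
  have 1: "(\<ominus>\<^bsub>K\<^esub> \<one>\<^bsub>K\<^esub>) \<odot>\<^bsub>KG\<^esub> group_algebra_of K \<one>\<^bsub>G\<^esub> \<in> carrier KG"
    by (intro KG_smult_closed group_algebra_of_closed) auto
  show ?thesis
    using assms pairing_add[OF assms(1) group_algebra_of_closed[OF assms(2)] 1]
      pairing_smult[OF assms(1) group_algebra_of_closed[OF G.one_closed], of "\<ominus>\<^bsub>K\<^esub> \<one>\<^bsub>K\<^esub>"]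
    by (simp add: KG_minus group_algebra_of_closed pairing_of K.minus_eq K.l_minus Pi_iff del: KG_simps(3,4))
qed

lemma pairing_fun_add:
  assumes "\<phi> \<in> carrier G \<rightarrow> carrier K" "\<psi> \<in> carrier G \<rightarrow> carrier K" "f \<in> carrier KG"
  shows "pairing (\<lambda>x. \<phi> x \<oplus>\<^bsub>K\<^esub> \<psi> x) f = pairing \<phi> f \<oplus>\<^bsub>K\<^esub> pairing \<psi> f"
proof -
  have S: "supp f \<subseteq> carrier G" and c: "f x \<in> carrier K" for x
    using assms by (auto simp: KG_carrier)
  have "pairing (\<lambda>x. \<phi> x \<oplus>\<^bsub>K\<^esub> \<psi> x) f = (\<Oplus>\<^bsub>K\<^esub>x \<in> supp f. f x \<otimes>\<^bsub>K\<^esub> \<phi> x \<oplus>\<^bsub>K\<^esub> f x \<otimes>\<^bsub>K\<^esub> \<psi> x)"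
    unfolding pairing_def using assms S c
    by (intro K.finsum_cong') (auto simp: K.r_distr Pi_iff subset_iff)
  also have "\<dots> = pairing \<phi> f \<oplus>\<^bsub>K\<^esub> pairing \<psi> f"
    unfolding pairing_def using assms S c
    by (intro K.finsum_addf) (auto simp: Pi_iff subset_iff)
  finally show ?thesis .
qed

lemma pairing_fun_cong:
  assumes "\<psi> \<in> carrier G \<rightarrow> carrier K" "f \<in> carrier KG" "\<And>x. x \<in> carrier G \<Longrightarrow> \<phi> x = \<psi> x"
  shows "pairing \<phi> f = pairing \<psi> f"
  unfolding pairing_def using assms
  by (intro K.finsum_cong') (auto simp: KG_carrier Pi_iff subset_iff)

lemma pairing_const:
  assumes "c \<in> carrier K" "f \<in> carrier KG"
  shows "pairing (\<lambda>x. c) f = augmentation K f \<otimes>\<^bsub>K\<^esub> c"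
  unfolding pairing_def augmentation_def using assms
  by (intro K.finsum_ldistr[symmetric]) (auto simp: KG_carrier)

lemma KG_mult_support:
  "supp (f \<otimes>\<^bsub>KG\<^esub> u) \<subseteq> (\<lambda>ab. fst ab \<otimes>\<^bsub>G\<^esub> snd ab) ` (supp f \<times> supp u)"
proof
  fix x assume x: "x \<in> supp (f \<otimes>\<^bsub>KG\<^esub> u)"
  define P where "P = {ab \<in> carrier G \<times> carrier G.
        f (fst ab) \<noteq> \<zero>\<^bsub>K\<^esub> \<and> u (snd ab) \<noteq> \<zero>\<^bsub>K\<^esub> \<and> fst ab \<otimes>\<^bsub>G\<^esub> snd ab = x}"
  have "(f \<otimes>\<^bsub>KG\<^esub> u) x = (\<Oplus>\<^bsub>K\<^esub>ab\<in>P. f (fst ab) \<otimes>\<^bsub>K\<^esub> u (snd ab))"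
    by (simp add: group_algebra_def P_def)
  then have "P \<noteq> {}" using x by auto
  then show "x \<in> (\<lambda>ab. fst ab \<otimes>\<^bsub>G\<^esub> snd ab) ` (supp f \<times> supp u)"
    by (force simp: P_def)
qed

lemma KG_mult_closed:
  assumes "f \<in> carrier KG" "u \<in> carrier KG"
  shows "f \<otimes>\<^bsub>KG\<^esub> u \<in> carrier KG"
proof -
  have "(f \<otimes>\<^bsub>KG\<^esub> u) x \<in> carrier K" for x
    unfolding group_algebra_def
    by (simp, rule K.finsum_closed) (use assms in \<open>auto simp: KG_carrier\<close>)
  moreover have "finite ((\<lambda>ab. fst ab \<otimes>\<^bsub>G\<^esub> snd ab) ` (supp f \<times> supp u))"
    "(\<lambda>ab. fst ab \<otimes>\<^bsub>G\<^esub> snd ab) ` (supp f \<times> supp u) \<subseteq> carrier G"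
    using assms by (fastforce simp: KG_carrier)+
  ultimately show ?thesis
    unfolding KG_carrier
    by (intro conjI allI finite_subset[OF KG_mult_support] subset_trans[OF KG_mult_support])
qed

text \<open>
  Summing over all pairs of support points at once, or first over the left factor, gives the same
  result. In this form a product of an element of \<open>\<Delta>\<^sup>n\<close> with one of \<open>\<Delta>\<close> is handled one factor at
  a time.
\<close>

lemma pairing_mult:
  assumes \<phi>: "\<phi> \<in> carrier G \<rightarrow> carrier K" and f: "f \<in> carrier KG" and u: "u \<in> carrier KG"
  shows "pairing \<phi> (f \<otimes>\<^bsub>KG\<^esub> u) = pairing (\<lambda>b. pairing (\<lambda>a. \<phi> (a \<otimes>\<^bsub>G\<^esub> b)) f) u"
proof -
  define \<mu> where "\<mu> = (\<lambda>ab. fst ab \<otimes>\<^bsub>G\<^esub> snd ab)"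
  define P where "P = supp f \<times> supp u"
  define t where "t = (\<lambda>ab. f (fst ab) \<otimes>\<^bsub>K\<^esub> u (snd ab) \<otimes>\<^bsub>K\<^esub> \<phi> (\<mu> ab))"
  have fin: "finite P" "finite (supp u)" "finite (supp f)" and PG: "P \<subseteq> carrier G \<times> carrier G"
    and fc: "f x \<in> carrier K" and uc: "u x \<in> carrier K" and sG: "supp u \<subseteq> carrier G" "supp f \<subseteq> carrier G" for x
    using f u by (auto simp: P_def KG_carrier)
  have \<mu>G: "\<mu> ab \<in> carrier G" if "ab \<in> P" for ab
    using that PG by (auto simp: \<mu>_def)
  have tK: "t ab \<in> carrier K" if "ab \<in> P" for ab
    using \<mu>G[OF that] \<phi> fc uc by (auto simp: t_def)
  have val: "(f \<otimes>\<^bsub>KG\<^esub> u) x \<otimes>\<^bsub>K\<^esub> \<phi> x = (\<Oplus>\<^bsub>K\<^esub>ab\<in>{ab \<in> P. \<mu> ab = x}. t ab)" if x: "x \<in> \<mu> ` P" for x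
  proof -
    have xG: "x \<in> carrier G" using x \<mu>G by auto
    have "{ab \<in> carrier G \<times> carrier G.
        f (fst ab) \<noteq> \<zero>\<^bsub>K\<^esub> \<and> u (snd ab) \<noteq> \<zero>\<^bsub>K\<^esub> \<and> fst ab \<otimes>\<^bsub>G\<^esub> snd ab = x} = {ab \<in> P. \<mu> ab = x}"
      using PG by (auto simp: P_def \<mu>_def)
    then have "(f \<otimes>\<^bsub>KG\<^esub> u) x = (\<Oplus>\<^bsub>K\<^esub>ab\<in>{ab \<in> P. \<mu> ab = x}. f (fst ab) \<otimes>\<^bsub>K\<^esub> u (snd ab))"
      by (simp add: group_algebra_def)
    then have "(f \<otimes>\<^bsub>KG\<^esub> u) x \<otimes>\<^bsub>K\<^esub> \<phi> x
        = (\<Oplus>\<^bsub>K\<^esub>ab\<in>{ab \<in> P. \<mu> ab = x}. f (fst ab) \<otimes>\<^bsub>K\<^esub> u (snd ab) \<otimes>\<^bsub>K\<^esub> \<phi> x)"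
      using fc uc \<phi> xG fin by (simp add: K.finsum_ldistr Pi_iff)
    also have "\<dots> = (\<Oplus>\<^bsub>K\<^esub>ab\<in>{ab \<in> P. \<mu> ab = x}. t ab)"
      using tK by (intro K.finsum_cong') (auto simp: t_def)
    finally show ?thesis .
  qed
  have "pairing \<phi> (f \<otimes>\<^bsub>KG\<^esub> u) = (\<Oplus>\<^bsub>K\<^esub>x\<in>\<mu> ` P. (f \<otimes>\<^bsub>KG\<^esub> u) x \<otimes>\<^bsub>K\<^esub> \<phi> x)"
  proof (rule pairing_superset[OF \<phi>])
    show "(f \<otimes>\<^bsub>KG\<^esub> u) x \<in> carrier K" for x using KG_mult_closed[OF f u] by (simp add: KG_carrier)
    show "supp (f \<otimes>\<^bsub>KG\<^esub> u) \<subseteq> \<mu> ` P" using KG_mult_support[of f u] by (simp add: \<mu>_def P_def)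
  qed (use \<mu>G fin in auto)
  also have "\<dots> = (\<Oplus>\<^bsub>K\<^esub>x\<in>\<mu> ` P. \<Oplus>\<^bsub>K\<^esub>ab\<in>{ab \<in> P. \<mu> ab = x}. t ab)"
    using tK by (intro K.finsum_cong' val) auto
  also have "\<dots> = (\<Oplus>\<^bsub>K\<^esub>ab\<in>(\<Union>x\<in>\<mu> ` P. {ab \<in> P. \<mu> ab = x}). t ab)"
    using tK fin by (intro K.add.finprod_UN_disjoint[symmetric]) (auto simp: pairwise_def disjnt_def)
  also have "(\<Union>x\<in>\<mu> ` P. {ab \<in> P. \<mu> ab = x}) = (\<Union>b\<in>supp u. (\<lambda>a. (a, b)) ` supp f)"
    by (auto simp: P_def)
  also have "(\<Oplus>\<^bsub>K\<^esub>ab\<in>\<dots>. t ab) = (\<Oplus>\<^bsub>K\<^esub>b\<in>supp u. \<Oplus>\<^bsub>K\<^esub>ab\<in>(\<lambda>a. (a, b)) ` supp f. t ab)"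
    using tK fin by (intro K.add.finprod_UN_disjoint) (auto simp: pairwise_def disjnt_def P_def)
  also have "\<dots> = (\<Oplus>\<^bsub>K\<^esub>b\<in>supp u. u b \<otimes>\<^bsub>K\<^esub> pairing (\<lambda>a. \<phi> (a \<otimes>\<^bsub>G\<^esub> b)) f)"
  proof (rule K.finsum_cong')
    fix b assume b: "b \<in> supp u"
    have c: "\<phi> (a \<otimes>\<^bsub>G\<^esub> b) \<in> carrier K" if "a \<in> supp f" for a
      using that b sG \<phi> by (auto simp: Pi_iff)
    have "(\<Oplus>\<^bsub>K\<^esub>ab\<in>(\<lambda>a. (a, b)) ` supp f. t ab) = (\<Oplus>\<^bsub>K\<^esub>a\<in>supp f. t (a, b))"
      using tK b by (intro K.add.finprod_reindex) (auto simp: P_def inj_on_def)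
    also have "\<dots> = (\<Oplus>\<^bsub>K\<^esub>a\<in>supp f. u b \<otimes>\<^bsub>K\<^esub> (f a \<otimes>\<^bsub>K\<^esub> \<phi> (a \<otimes>\<^bsub>G\<^esub> b)))"
      using c fc uc by (intro K.finsum_cong') (auto simp: t_def \<mu>_def K.m_ac)
    also have "\<dots> = u b \<otimes>\<^bsub>K\<^esub> pairing (\<lambda>a. \<phi> (a \<otimes>\<^bsub>G\<^esub> b)) f"
      unfolding pairing_def using c fc uc fin
      by (intro K.finsum_rdistr[symmetric]) auto
    finally show "(\<Oplus>\<^bsub>K\<^esub>ab\<in>(\<lambda>a. (a, b)) ` supp f. t ab)
        = u b \<otimes>\<^bsub>K\<^esub> pairing (\<lambda>a. \<phi> (a \<otimes>\<^bsub>G\<^esub> b)) f" .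
  next
    show "(\<lambda>b. u b \<otimes>\<^bsub>K\<^esub> pairing (\<lambda>a. \<phi> (a \<otimes>\<^bsub>G\<^esub> b)) f) \<in> supp u \<rightarrow> carrier K"
    proof
      fix b assume "b \<in> supp u"
      then have "b \<in> carrier G" using sG by auto
      then have "(\<lambda>a. \<phi> (a \<otimes>\<^bsub>G\<^esub> b)) \<in> carrier G \<rightarrow> carrier K" using \<phi> by (auto simp: Pi_iff)
      then show "u b \<otimes>\<^bsub>K\<^esub> pairing (\<lambda>a. \<phi> (a \<otimes>\<^bsub>G\<^esub> b)) f \<in> carrier K"
        using pairing_closed[OF _ f] uc by blast
    qed
  qed simp
  also have "\<dots> = pairing (\<lambda>b. pairing (\<lambda>a. \<phi> (a \<otimes>\<^bsub>G\<^esub> b)) f) u"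
    by (simp add: pairing_def)
  finally show ?thesis .
qed

end

section \<open>Dimension subgroups and polynomial functions\<close>

context field_and_group
begin

abbreviation aug_pow :: "nat \<Rightarrow> ('g \<Rightarrow> 'k) set"
  where "aug_pow n \<equiv> augmentation_ideal K G [^]\<^bsub>ideals_set KG\<^esub> n"

lemma aug_pow_0: "aug_pow 0 = carrier KG"
  by (simp add: nat_pow_def ideals_set_def)

lemma aug_pow_Suc: "aug_pow (Suc n) = ideal_prod KG (aug_pow n) (augmentation_ideal K G)"
  by (simp add: nat_pow_def ideals_set_def)

lemma augmentation_ideal_eq:
  "augmentation_ideal K G = {f \<in> carrier KG. augmentation K f = \<zero>\<^bsub>K\<^esub>}"
  by (simp add: augmentation_ideal_def a_kernel_def')

lemma aug_pow_closed: "f \<in> aug_pow n \<Longrightarrow> f \<in> carrier KG"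
proof (induction n arbitrary: f)
  case 0
  then show ?case by (simp only: aug_pow_0)
next
  case (Suc n)
  from Suc.prems show ?case
    unfolding aug_pow_Suc
    by (induction rule: ideal_prod.induct)
      (auto simp only: KG_add_closed KG_mult_closed Suc.IH augmentation_ideal_eq mem_Collect_eq)
qed

lemma zero_smult_KG: "f \<in> carrier KG \<Longrightarrow> \<zero>\<^bsub>K\<^esub> \<odot>\<^bsub>KG\<^esub> f = \<zero>\<^bsub>KG\<^esub>"
  by (auto simp: KG_carrier)

lemma smult_KG_mult:
  assumes "c \<in> carrier K" "f \<in> carrier KG" "u \<in> carrier KG"
  shows "c \<odot>\<^bsub>KG\<^esub> (f \<otimes>\<^bsub>KG\<^esub> u) = (c \<odot>\<^bsub>KG\<^esub> f) \<otimes>\<^bsub>KG\<^esub> u"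
proof
  fix x
  define P where "P f = {ab \<in> carrier G \<times> carrier G.
        f (fst ab) \<noteq> \<zero>\<^bsub>K\<^esub> \<and> u (snd ab) \<noteq> \<zero>\<^bsub>K\<^esub> \<and> fst ab \<otimes>\<^bsub>G\<^esub> snd ab = x}" for f
  have mult: "(f' \<otimes>\<^bsub>KG\<^esub> u) x = (\<Oplus>\<^bsub>K\<^esub>ab\<in>P f'. f' (fst ab) \<otimes>\<^bsub>K\<^esub> u (snd ab))" for f'
    by (simp add: group_algebra_def P_def)
  have fc: "f y \<in> carrier K" and uc: "u y \<in> carrier K" for y using assms by (auto simp: KG_carrier)
  have fin: "finite (P f)"
    by (rule finite_subset[of _ "supp f \<times> supp u"]) (use assms in \<open>auto simp: P_def KG_carrier\<close>)
  have "(c \<odot>\<^bsub>KG\<^esub> (f \<otimes>\<^bsub>KG\<^esub> u)) x = c \<otimes>\<^bsub>K\<^esub> (\<Oplus>\<^bsub>K\<^esub>ab\<in>P f. f (fst ab) \<otimes>\<^bsub>K\<^esub> u (snd ab))"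
    by (simp add: mult)
  also have "\<dots> = (\<Oplus>\<^bsub>K\<^esub>ab\<in>P f. c \<otimes>\<^bsub>K\<^esub> (f (fst ab) \<otimes>\<^bsub>K\<^esub> u (snd ab)))"
    using fin fc uc assms by (intro K.finsum_rdistr) auto
  also have "\<dots> = (\<Oplus>\<^bsub>K\<^esub>ab\<in>P (c \<odot>\<^bsub>KG\<^esub> f). (c \<odot>\<^bsub>KG\<^esub> f) (fst ab) \<otimes>\<^bsub>K\<^esub> u (snd ab))"
    using fin fc uc assms
    by (intro K.add.finprod_mono_neutral_cong_right)
      (auto simp: P_def K.m_assoc[symmetric] KG_carrier)
  also have "\<dots> = ((c \<odot>\<^bsub>KG\<^esub> f) \<otimes>\<^bsub>KG\<^esub> u) x" by (simp only: mult)
  finally show "(c \<odot>\<^bsub>KG\<^esub> (f \<otimes>\<^bsub>KG\<^esub> u)) x = ((c \<odot>\<^bsub>KG\<^esub> f) \<otimes>\<^bsub>KG\<^esub> u) x" .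
qed

text \<open>
  Products of ideals are defined as additive spans; they are nevertheless linear subspaces, because
  a scalar can be moved into the left factor.
\<close>

lemma aug_pow_smult:
  "c \<in> carrier K \<Longrightarrow> f \<in> aug_pow n \<Longrightarrow> c \<odot>\<^bsub>KG\<^esub> f \<in> aug_pow n"
proof (induction n arbitrary: f)
  case 0
  then show ?case unfolding aug_pow_0 by (intro KG_smult_closed)
next
  case (Suc n)
  interpret V: vectorspace K KG by (rule KG_vectorspace)
  have aug: "u \<in> carrier KG" if "u \<in> augmentation_ideal K G" for u
    using that by (simp add: augmentation_ideal_eq)
  from Suc.prems(2) show ?case
    unfolding aug_pow_Suc
  proof (induction rule: ideal_prod.induct)
    case (prod f u)
    then show ?case
      using Suc smult_KG_mult[OF Suc.prems(1), of f u] aug aug_pow_closed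
      by (simp only: ideal_prod.prod)
  next
    case (sum f h)
    then have "f \<in> carrier KG" "h \<in> carrier KG"
      using aug_pow_closed[of _ "Suc n"] unfolding aug_pow_Suc by blast+
    then show ?case
      using sum Suc.prems by (simp only: V.smult_r_distr ideal_prod.sum)
  qed
qed

lemma aug_pow_add: "f \<in> aug_pow n \<Longrightarrow> h \<in> aug_pow n \<Longrightarrow> f \<oplus>\<^bsub>KG\<^esub> h \<in> aug_pow n"
proof (cases n)
  case 0
  assume "f \<in> aug_pow n" "h \<in> aug_pow n"
  then show ?thesis unfolding 0 aug_pow_0 by (rule KG_add_closed)
next
  case (Suc m)
  assume "f \<in> aug_pow n" "h \<in> aug_pow n"
  then show ?thesis unfolding Suc aug_pow_Suc by (rule ideal_prod.sum)
qed

lemma aug_pow_zero: "\<zero>\<^bsub>KG\<^esub> \<in> aug_pow n"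
proof -
  have "\<exists>f. f \<in> aug_pow n"
  proof (induction n)
    case 0
    then show ?case using KG_zero_closed unfolding aug_pow_0 by blast
  next
    case (Suc n)
    have "\<zero>\<^bsub>KG\<^esub> \<in> augmentation_ideal K G"
      using KG_zero_closed by (simp add: augmentation_ideal_eq augmentation_def)
    then show ?case using Suc unfolding aug_pow_Suc by (blast intro: ideal_prod.prod)
  qed
  then obtain f where f: "f \<in> aug_pow n" by blast
  then show ?thesis
    using aug_pow_smult[OF K.zero_closed f] zero_smult_KG[OF aug_pow_closed[OF f]] by (simp only:)
qed

text \<open>
  For \<open>f \<in> \<Delta>\<^sup>n\<close> and \<open>\<phi>\<close> of degree at most \<open>n\<close>, translating \<open>\<phi>\<close> does not change its value at \<open>f\<close>,
  since the difference has degree less than \<open>n\<close>. So pairing \<open>\<phi>\<close> with \<open>f u\<close> multiplies that value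
  by the augmentation of \<open>u\<close>, which is zero for \<open>u \<in> \<Delta>\<close>.
\<close>

lemma pairing_aug_pow_eq_zero:
  "poly_fun n \<phi> \<Longrightarrow> f \<in> aug_pow n \<Longrightarrow> pairing \<phi> f = \<zero>\<^bsub>K\<^esub>"
proof (induction n arbitrary: \<phi> f)
  case 0
  then have "supp f \<subseteq> carrier G" "\<And>x. f x \<in> carrier K"
    using aug_pow_closed[of f 0] by (auto simp only: KG_carrier)
  then show ?case
    unfolding pairing_def using 0
    by (intro K.add.finprod_one_eqI) auto
next
  case (Suc n)
  have \<phi>: "\<phi> \<in> carrier G \<rightarrow> carrier K" using Suc.prems by auto
  from Suc.prems(2) show ?case
    unfolding aug_pow_Suc
  proof (induction rule: ideal_prod.induct)
    case (prod f u)
    have f: "f \<in> carrier KG" using prod aug_pow_closed by blast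
    have u: "u \<in> carrier KG" "augmentation K u = \<zero>\<^bsub>K\<^esub>"
      using prod by (auto simp only: augmentation_ideal_eq)
    have const: "pairing (\<lambda>a. \<phi> (a \<otimes>\<^bsub>G\<^esub> b)) f = pairing \<phi> f" if b: "b \<in> carrier G" for b
    proof -
      have d: "poly_fun n (right_diff b \<phi>)" using Suc.prems b by auto
      have "pairing (\<lambda>a. \<phi> (a \<otimes>\<^bsub>G\<^esub> b)) f = pairing (\<lambda>a. right_diff b \<phi> a \<oplus>\<^bsub>K\<^esub> \<phi> a) f"
        using \<phi> b f by (intro pairing_fun_cong)
          (auto simp: right_diff_def Pi_iff K.minus_eq K.a_assoc K.l_neg)
      also have "\<dots> = pairing (right_diff b \<phi>) f \<oplus>\<^bsub>K\<^esub> pairing \<phi> f"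
        using \<phi> poly_fun_closed[OF d] f by (intro pairing_fun_add) auto
      also have "\<dots> = pairing \<phi> f"
        using Suc.IH[OF d] prod pairing_closed[OF \<phi> f] by simp
      finally show ?thesis .
    qed
    have "pairing \<phi> (f \<otimes>\<^bsub>KG\<^esub> u) = pairing (\<lambda>b. pairing \<phi> f) u"
      unfolding pairing_mult[OF \<phi> f u(1)]
      by (rule pairing_fun_cong) (use const pairing_closed[OF \<phi> f] u in auto)
    also have "\<dots> = \<zero>\<^bsub>K\<^esub>"
      using pairing_const[OF pairing_closed[OF \<phi> f] u(1)] u(2) pairing_closed[OF \<phi> f] by simp
    finally show ?case .
  next
    case (sum f h)
    then have "f \<in> carrier KG" "h \<in> carrier KG"
      using aug_pow_closed[of _ "Suc n"] unfolding aug_pow_Suc by blast+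
    then show ?case
      using sum \<phi> by (simp only: pairing_add) simp
  qed
qed

text \<open>
  Conversely, the value at \<open>f\<close> of the difference of \<open>\<phi>\<close> along \<open>h\<close> is the value of \<open>\<phi>\<close> at
  \<open>f (h - 1)\<close>, so annihilating \<open>\<Delta>\<^sup>n\<close> passes down to differences.
\<close>

lemma poly_funI_pairing:
  "\<phi> \<in> carrier G \<rightarrow> carrier K \<Longrightarrow> (\<And>f. f \<in> aug_pow n \<Longrightarrow> pairing \<phi> f = \<zero>\<^bsub>K\<^esub>) \<Longrightarrow> poly_fun n \<phi>"
proof (induction n arbitrary: \<phi>)
  case 0
  show ?case
    using 0 group_algebra_of_closed pairing_of unfolding aug_pow_0 poly_fun.simps by metis
next
  case (Suc n)
  have \<phi>: "\<phi> \<in> carrier G \<rightarrow> carrier K" by fact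
  have "poly_fun n (right_diff h \<phi>)" if h: "h \<in> carrier G" for h
  proof (rule Suc.IH)
    show "right_diff h \<phi> \<in> carrier G \<rightarrow> carrier K" using \<phi> h by (auto simp: right_diff_def)
    fix f assume f: "f \<in> aug_pow n"
    have fK: "f \<in> carrier KG" by (rule aug_pow_closed[OF f])
    define u where "u = group_algebra_of K h \<ominus>\<^bsub>KG\<^esub> \<one>\<^bsub>KG\<^esub>"
    interpret V: vectorspace K KG by (rule KG_vectorspace)
    have uK: "u \<in> carrier KG"
      using group_algebra_of_closed[OF h] group_algebra_of_closed[OF G.one_closed]
      unfolding u_def KG_simps(2) by (rule V.M.minus_closed)
    have one: "(\<lambda>x. \<one>\<^bsub>K\<^esub>) \<in> carrier G \<rightarrow> carrier K" by auto
    have "augmentation K u = pairing (\<lambda>x. \<one>\<^bsub>K\<^esub>) u"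
      unfolding augmentation_def pairing_def using uK
      by (intro K.finsum_cong') (auto simp: KG_carrier)
    also have "\<dots> = \<zero>\<^bsub>K\<^esub>" unfolding u_def pairing_minus_one[OF one h] by (simp add: K.minus_eq K.r_neg)
    finally have "u \<in> augmentation_ideal K G" using uK by (simp only: augmentation_ideal_eq) simp
    then have "f \<otimes>\<^bsub>KG\<^esub> u \<in> aug_pow (Suc n)" unfolding aug_pow_Suc by (rule ideal_prod.prod[OF f])
    then have "pairing (\<lambda>b. pairing (\<lambda>a. \<phi> (a \<otimes>\<^bsub>G\<^esub> b)) f) u = \<zero>\<^bsub>K\<^esub>"
      using Suc.prems(2) pairing_mult[OF \<phi> fK uK] by simp
    moreover have "(\<lambda>b. pairing (\<lambda>a. \<phi> (a \<otimes>\<^bsub>G\<^esub> b)) f) \<in> carrier G \<rightarrow> carrier K"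
    proof
      fix b assume "b \<in> carrier G"
      then have "(\<lambda>a. \<phi> (a \<otimes>\<^bsub>G\<^esub> b)) \<in> carrier G \<rightarrow> carrier K"
        using \<phi> by (auto simp: Pi_iff)
      then show "pairing (\<lambda>a. \<phi> (a \<otimes>\<^bsub>G\<^esub> b)) f \<in> carrier K"
        using fK by (rule pairing_closed)
    qed
    ultimately have "pairing (\<lambda>a. \<phi> (a \<otimes>\<^bsub>G\<^esub> h)) f \<ominus>\<^bsub>K\<^esub> pairing (\<lambda>a. \<phi> (a \<otimes>\<^bsub>G\<^esub> \<one>\<^bsub>G\<^esub>)) f = \<zero>\<^bsub>K\<^esub>"
      using pairing_minus_one[OF _ h] unfolding u_def by simp
    moreover have "pairing (\<lambda>a. \<phi> (a \<otimes>\<^bsub>G\<^esub> \<one>\<^bsub>G\<^esub>)) f = pairing \<phi> f"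
      using \<phi> fK by (intro pairing_fun_cong) auto
    moreover have "pairing (\<lambda>a. \<phi> (a \<otimes>\<^bsub>G\<^esub> h)) f = pairing (\<lambda>a. right_diff h \<phi> a \<oplus>\<^bsub>K\<^esub> \<phi> a) f"
      using \<phi> h fK by (intro pairing_fun_cong)
        (auto simp: right_diff_def Pi_iff K.minus_eq K.a_assoc K.l_neg)
    moreover have "\<dots> = pairing (right_diff h \<phi>) f \<oplus>\<^bsub>K\<^esub> pairing \<phi> f"
      using \<phi> h fK by (intro pairing_fun_add) (auto simp: right_diff_def)
    moreover have "pairing (right_diff h \<phi>) f \<in> carrier K"
      using \<phi> h by (intro pairing_closed fK) (auto simp: right_diff_def)
    ultimately show "pairing (right_diff h \<phi>) f = \<zero>\<^bsub>K\<^esub>"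
      using pairing_closed[OF \<phi> fK] by (simp add: K.minus_eq K.a_assoc K.r_neg)
  qed
  then show ?case using \<phi> by simp
qed

lemma linear_functional_eq_pairing:
  assumes F: "F \<in> carrier KG \<rightarrow> carrier K"
    and Fadd: "\<And>x y. x \<in> carrier KG \<Longrightarrow> y \<in> carrier KG \<Longrightarrow> F (x \<oplus>\<^bsub>KG\<^esub> y) = F x \<oplus>\<^bsub>K\<^esub> F y"
    and Fsm: "\<And>c x. c \<in> carrier K \<Longrightarrow> x \<in> carrier KG \<Longrightarrow> F (c \<odot>\<^bsub>KG\<^esub> x) = c \<otimes>\<^bsub>K\<^esub> F x"
    and f: "f \<in> carrier KG"
  shows "F f = pairing (\<lambda>g. F (group_algebra_of K g)) f"
proof -
  let ?\<phi> = "\<lambda>g. F (group_algebra_of K g)"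
  have \<phi>: "?\<phi> \<in> carrier G \<rightarrow> carrier K" using F group_algebra_of_closed by blast
  have F0: "F (\<lambda>x. \<zero>\<^bsub>K\<^esub>) = \<zero>\<^bsub>K\<^esub>"
  proof -
    have "F (\<lambda>x. \<zero>\<^bsub>K\<^esub>) \<in> carrier K" using F KG_zero_closed by auto
    then have "\<zero>\<^bsub>K\<^esub> \<otimes>\<^bsub>K\<^esub> F (\<lambda>x. \<zero>\<^bsub>K\<^esub>) = \<zero>\<^bsub>K\<^esub>" by (rule K.l_null)
    then show ?thesis
      using Fsm[OF K.zero_closed KG_zero_closed] zero_smult_KG[OF KG_zero_closed] by simp
  qed
  have "F f = pairing ?\<phi> f" if "finite S" "supp f \<subseteq> S" "f \<in> carrier KG" for S f
    using that
  proof (induction S arbitrary: f rule: finite_induct)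
    case empty
    then have "f = (\<lambda>x. \<zero>\<^bsub>K\<^esub>)" by auto
    then show ?case using F0 by (simp add: pairing_def)
  next
    case (insert s S)
    show ?case
    proof (cases "f s = \<zero>\<^bsub>K\<^esub>")
      case True
      then have "supp f \<subseteq> S" using insert.prems by auto
      then show ?thesis using insert by blast
    next
      case False
      then have s: "s \<in> carrier G" "f s \<in> carrier K" using insert.prems by (auto simp: KG_carrier)
      define h where "h = f(s := \<zero>\<^bsub>K\<^esub>)"
      have "supp h \<subseteq> supp f" "\<And>x. f x \<in> carrier K \<Longrightarrow> h x \<in> carrier K" by (auto simp: h_def)
      then have h: "h \<in> carrier KG"
        using insert.prems finite_subset[of "supp h" "supp f"] unfolding KG_carrier by blast
      have hs: "supp h \<subseteq> S" using insert.prems by (auto simp: h_def)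
      have \<delta>: "group_algebra_of K s \<in> carrier KG" by (rule group_algebra_of_closed[OF s(1)])
      have eq: "f = h \<oplus>\<^bsub>KG\<^esub> f s \<odot>\<^bsub>KG\<^esub> group_algebra_of K s"
        using insert.prems s by (auto simp: h_def group_algebra_of_def KG_carrier)
      have c\<delta>: "f s \<odot>\<^bsub>KG\<^esub> group_algebra_of K s \<in> carrier KG" by (rule KG_smult_closed[OF s(2) \<delta>])
      have "F f = F h \<oplus>\<^bsub>K\<^esub> f s \<otimes>\<^bsub>K\<^esub> F (group_algebra_of K s)"
        using Fadd[OF h c\<delta>] Fsm[OF s(2) \<delta>] eq by simp
      also have "\<dots> = pairing ?\<phi> h \<oplus>\<^bsub>K\<^esub> f s \<otimes>\<^bsub>K\<^esub> pairing ?\<phi> (group_algebra_of K s)"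
        using insert.IH[OF hs h] pairing_of[OF \<phi> s(1)] by simp
      also have "\<dots> = pairing ?\<phi> f"
        using pairing_add[OF \<phi> h c\<delta>] pairing_smult[OF \<phi> \<delta> s(2)] eq by simp
      finally show ?thesis .
    qed
  qed
  then show ?thesis using f by (auto simp: KG_carrier)
qed

text \<open>
  Functions of degree less than \<open>n\<close> annihilate \<open>\<Delta>\<^sup>n\<close>, so they take the same value at \<open>g\<close> and at the
  identity if \<open>g - 1 \<in> \<Delta>\<^sup>n\<close>. If \<open>g - 1 \<notin> \<Delta>\<^sup>n\<close>, a linear functional that vanishes on \<open>\<Delta>\<^sup>n\<close> and not at
  \<open>g - 1\<close> restricts to a polynomial function on \<open>G\<close> that tells them apart.
\<close>

theorem dimension_subgroup_iff_poly_fun: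
  "g \<in> dimension_subgroup K G n \<longleftrightarrow> g \<in> carrier G \<and> (\<forall>\<phi>. poly_fun n \<phi> \<longrightarrow> \<phi> g = \<phi> \<one>\<^bsub>G\<^esub>)"
proof (cases "g \<in> carrier G")
  case False
  then show ?thesis by (simp add: dimension_subgroup_def)
next
  case g: True
  interpret V: vectorspace K KG by (rule KG_vectorspace)
  define v where "v = group_algebra_of K g \<ominus>\<^bsub>KG\<^esub> \<one>\<^bsub>KG\<^esub>"
  have v: "v \<in> carrier KG"
    using group_algebra_of_closed[OF g] group_algebra_of_closed[OF G.one_closed]
    unfolding v_def KG_simps(2) by (rule V.M.minus_closed)
  have pv: "pairing \<phi> v = \<phi> g \<ominus>\<^bsub>K\<^esub> \<phi> \<one>\<^bsub>G\<^esub>" if "\<phi> \<in> carrier G \<rightarrow> carrier K" for \<phi>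
    unfolding v_def by (rule pairing_minus_one[OF that g])
  have "v \<in> aug_pow n \<longleftrightarrow> (\<forall>\<phi>. poly_fun n \<phi> \<longrightarrow> \<phi> g = \<phi> \<one>\<^bsub>G\<^esub>)"
  proof
    assume "v \<in> aug_pow n"
    then have "\<phi> g \<ominus>\<^bsub>K\<^esub> \<phi> \<one>\<^bsub>G\<^esub> = \<zero>\<^bsub>K\<^esub>" if "poly_fun n \<phi>" for \<phi>
      using pairing_aug_pow_eq_zero[OF that] pv[of \<phi>] poly_fun_closed[OF that] by auto
    then show "\<forall>\<phi>. poly_fun n \<phi> \<longrightarrow> \<phi> g = \<phi> \<one>\<^bsub>G\<^esub>"
      using g poly_fun_closed K.r_right_minus_eq by (meson G.one_closed)
  next
    assume *: "\<forall>\<phi>. poly_fun n \<phi> \<longrightarrow> \<phi> g = \<phi> \<one>\<^bsub>G\<^esub>"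
    show "v \<in> aug_pow n"
    proof (rule ccontr)
      assume "v \<notin> aug_pow n"
      show False
      proof (rule V.separating_functional[OF aug_pow_zero subsetI[OF aug_pow_closed]
            aug_pow_add aug_pow_smult v \<open>v \<notin> aug_pow n\<close>])
        fix F
        assume F: "F \<in> carrier KG \<rightarrow> carrier K"
          "\<And>x y. x \<in> carrier KG \<Longrightarrow> y \<in> carrier KG \<Longrightarrow> F (x \<oplus>\<^bsub>KG\<^esub> y) = F x \<oplus>\<^bsub>K\<^esub> F y"
          "\<And>c x. c \<in> carrier K \<Longrightarrow> x \<in> carrier KG \<Longrightarrow> F (c \<odot>\<^bsub>KG\<^esub> x) = c \<otimes>\<^bsub>K\<^esub> F x"
          "\<And>x. x \<in> aug_pow n \<Longrightarrow> F x = \<zero>\<^bsub>K\<^esub>" "F v = \<one>\<^bsub>K\<^esub>"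
        define \<phi> where "\<phi> = (\<lambda>g. F (group_algebra_of K g))"
        have \<phi>: "\<phi> \<in> carrier G \<rightarrow> carrier K" using F(1) group_algebra_of_closed unfolding \<phi>_def by blast
        have Fp: "F f = pairing \<phi> f" if "f \<in> carrier KG" for f
          unfolding \<phi>_def by (rule linear_functional_eq_pairing[OF F(1-3) that])
        have "poly_fun n \<phi>"
          by (rule poly_funI_pairing[OF \<phi>]) (use Fp F(4) aug_pow_closed in metis)
        then have "\<phi> g = \<phi> \<one>\<^bsub>G\<^esub>" using * by blast
        then have "F v = \<zero>\<^bsub>K\<^esub>" using Fp[OF v] pv[OF \<phi>] \<phi> by (simp add: K.minus_eq K.r_neg Pi_iff)
        then show False using F(5) by simp
      qed
    qed
  qed
  then show ?thesis using g by (simp add: dimension_subgroup_def v_def)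
qed

end

section \<open>Extension of scalars to a field\<close>

locale tensor_with_field = K: field K + M: group M
  for K :: "('k, 'c) ring_scheme" and M :: "('m, 'd) monoid_scheme"
begin

abbreviation F where "F \<equiv> free_Abelian_group (carrier M \<times> carrier K)"
abbreviation R where "R \<equiv> tensor_relations M K"
abbreviation V where "V \<equiv> tensor_module M K"

abbreviation pairs where "pairs \<equiv> carrier M \<times> carrier K"

definition tcoset where "tcoset f = R #>\<^bsub>F\<^esub> f"

definition scale where "scale c = frag_extend (\<lambda>(m, x). frag_of (m, c \<otimes>\<^bsub>K\<^esub> x))"

definition tensor where "tensor m x = tcoset (frag_of (m, x))"

lemma R_subgroup: "subgroup R F"
proof -
  have pairs_diff: "Poly_Mapping.keys (a - b - c) \<subseteq> pairs"
    if "Poly_Mapping.keys a \<subseteq> pairs" "Poly_Mapping.keys b \<subseteq> pairs" "Poly_Mapping.keys c \<subseteq> pairs"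
    for a b c :: "'m \<times> 'k \<Rightarrow>\<^sub>0 int"
    using that keys_diff[of "a - b" c] keys_diff[of a b] by blast
  show ?thesis
    unfolding tensor_relations_def
  proof (rule group.generate_is_subgroup, simp, rule subsetI)
    fix r assume "r \<in> {frag_of (m \<otimes>\<^bsub>M\<^esub> m', x) - frag_of (m, x) - frag_of (m', x) | m m' x.
        m \<in> carrier M \<and> m' \<in> carrier M \<and> x \<in> carrier K} \<union>
      {frag_of (m, x \<oplus>\<^bsub>K\<^esub> y) - frag_of (m, x) - frag_of (m, y) | m x y.
        m \<in> carrier M \<and> x \<in> carrier K \<and> y \<in> carrier K}"
    then obtain p q s where "r = frag_of p - frag_of q - frag_of s" "p \<in> pairs" "q \<in> pairs" "s \<in> pairs"
      by blast
    then show "r \<in> carrier F" using pairs_diff[of "frag_of p" "frag_of q" "frag_of s"] by simp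
  qed
qed

lemma R_normal: "R \<lhd> F"
  by (rule comm_group.subgroup_imp_normal[OF abelian_free_Abelian_group R_subgroup])

lemma R_zero: "0 \<in> R" and R_add: "r \<in> R \<Longrightarrow> s \<in> R \<Longrightarrow> r + s \<in> R"
  and R_keys: "r \<in> R \<Longrightarrow> Poly_Mapping.keys r \<subseteq> pairs"
  using subgroup.one_closed[OF R_subgroup] subgroup.m_closed[OF R_subgroup, of r s]
    subgroup.mem_carrier[OF R_subgroup, of r] by auto

lemma R_minus: "r \<in> R \<Longrightarrow> - r \<in> R"
  using subgroup.m_inv_closed[OF R_subgroup, of r] R_keys by simp

lemma R_mult_rel: "m \<in> carrier M \<Longrightarrow> m' \<in> carrier M \<Longrightarrow> x \<in> carrier K \<Longrightarrow>
    frag_of (m \<otimes>\<^bsub>M\<^esub> m', x) - frag_of (m, x) - frag_of (m', x) \<in> R"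
  unfolding tensor_relations_def by (rule generate.incl) blast

lemma R_add_rel: "m \<in> carrier M \<Longrightarrow> x \<in> carrier K \<Longrightarrow> y \<in> carrier K \<Longrightarrow>
    frag_of (m, x \<oplus>\<^bsub>K\<^esub> y) - frag_of (m, x) - frag_of (m, y) \<in> R"
  unfolding tensor_relations_def by (rule generate.incl) blast

lemma tcoset_eqI: "f - g \<in> R \<Longrightarrow> tcoset f = tcoset g"
proof -
  assume r: "f - g \<in> R"
  have "tcoset f \<subseteq> tcoset g" if fg: "f - g \<in> R" for f g
  proof
    fix h assume "h \<in> tcoset f"
    then obtain s where s: "s \<in> R" "h = s + f" unfolding tcoset_def r_coset_def by auto
    then have "h = (s + (f - g)) + g" by simp
    then show "h \<in> tcoset g"
      using R_add[OF s(1) fg] unfolding tcoset_def r_coset_def mult_free_Abelian_group by blast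
  qed
  from this[OF r] this[of g f] R_minus[OF r] show ?thesis by simp
qed

lemma carrier_V: "carrier V = tcoset ` {f. Poly_Mapping.keys f \<subseteq> pairs}"
  by (auto simp: tensor_module_def tensor_group_def FactGroup_def RCOSETS_def tcoset_def)

lemma V_zero: "\<zero>\<^bsub>V\<^esub> = tcoset 0"
  by (auto simp: tensor_module_def tensor_group_def FactGroup_def tcoset_def r_coset_def)

lemma V_add: "Poly_Mapping.keys f \<subseteq> pairs \<Longrightarrow> Poly_Mapping.keys g \<subseteq> pairs \<Longrightarrow>
    tcoset f \<oplus>\<^bsub>V\<^esub> tcoset g = tcoset (f + g)"
  using normal.rcos_sum[OF R_normal, of f g]
  by (simp add: tensor_module_def tensor_group_def FactGroup_def tcoset_def)

lemma scale_of: "scale c (frag_of (m, x)) = frag_of (m, c \<otimes>\<^bsub>K\<^esub> x)"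
  by (simp add: scale_def)

lemma scale_add: "scale c (f + g) = scale c f + scale c g"
  and scale_diff: "scale c (f - g) = scale c f - scale c g"
  and scale_uminus: "scale c (- f) = - scale c f"
  and scale_zero: "scale c 0 = 0"
  by (simp_all add: scale_def frag_extend_add frag_extend_diff frag_extend_minus)

lemma scale_keys: "c \<in> carrier K \<Longrightarrow> Poly_Mapping.keys f \<subseteq> pairs \<Longrightarrow>
    Poly_Mapping.keys (scale c f) \<subseteq> pairs"
proof -
  assume c: "c \<in> carrier K" and f: "Poly_Mapping.keys f \<subseteq> pairs"
  have image: "Poly_Mapping.keys ((\<lambda>(m, x). frag_of (m, c \<otimes>\<^bsub>K\<^esub> x)) p) \<subseteq> pairs"
    if "p \<in> pairs" for p
    using that c by (auto simp: keys_frag_of)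
  show ?thesis
    unfolding scale_def
    by (rule order_trans[OF keys_frag_extend], rule UN_least, rule image, rule subsetD[OF f])
qed

lemma scale_R: "c \<in> carrier K \<Longrightarrow> r \<in> R \<Longrightarrow> scale c r \<in> R"
proof -
  assume c: "c \<in> carrier K"
  define B where "B = {frag_of (m \<otimes>\<^bsub>M\<^esub> m', x) - frag_of (m, x) - frag_of (m', x) | m m' x.
        m \<in> carrier M \<and> m' \<in> carrier M \<and> x \<in> carrier K} \<union>
     {frag_of (m, x \<oplus>\<^bsub>K\<^esub> y) - frag_of (m, x) - frag_of (m, y) | m x y.
        m \<in> carrier M \<and> x \<in> carrier K \<and> y \<in> carrier K}"
  have RB: "R = generate F B" by (simp add: tensor_relations_def B_def)
  have B: "scale c b \<in> R" if "b \<in> B" for b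
    using that unfolding B_def
  proof (elim UnE CollectE exE conjE)
    fix m m' x assume "b = frag_of (m \<otimes>\<^bsub>M\<^esub> m', x) - frag_of (m, x) - frag_of (m', x)"
      "m \<in> carrier M" "m' \<in> carrier M" "x \<in> carrier K"
    then show ?thesis using R_mult_rel[of m m' "c \<otimes>\<^bsub>K\<^esub> x"] c by (simp add: scale_diff scale_of)
  next
    fix m x y assume "b = frag_of (m, x \<oplus>\<^bsub>K\<^esub> y) - frag_of (m, x) - frag_of (m, y)"
      "m \<in> carrier M" "x \<in> carrier K" "y \<in> carrier K"
    then show ?thesis
      using R_add_rel[of m "c \<otimes>\<^bsub>K\<^esub> x" "c \<otimes>\<^bsub>K\<^esub> y"] c
      by (simp add: scale_diff scale_of K.r_distr)
  qed
  assume "r \<in> R"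
  then show "scale c r \<in> R"
    unfolding RB[symmetric] unfolding RB
  proof (induction rule: generate.induct)
    case one
    then show ?case using R_zero by (simp add: scale_zero RB[symmetric])
  next
    case (incl h)
    then show ?case using B by (simp add: RB[symmetric])
  next
    case (inv h)
    then have "Poly_Mapping.keys h \<subseteq> pairs" using R_keys[of h] by (simp add: RB generate.incl)
    then show ?case using B[OF inv] R_minus by (simp add: scale_uminus RB[symmetric])
  next
    case (eng h1 h2)
    then show ?case using R_add by (simp add: scale_add RB[symmetric])
  qed
qed

text \<open>
  Scalar multiplication of a coset is defined as a union over its members; it is well defined
  because scaling the second components maps relations to relations.
\<close>

lemma V_smult:
  assumes "c \<in> carrier K" "Poly_Mapping.keys f \<subseteq> pairs"
  shows "c \<odot>\<^bsub>V\<^esub> tcoset f = tcoset (scale c f)"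
proof -
  have eq: "tcoset (scale c g) = tcoset (scale c f)" if g: "g \<in> tcoset f" for g
  proof -
    obtain r where "r \<in> R" "g = r + f" using g by (auto simp: tcoset_def r_coset_def)
    then show ?thesis using scale_R[OF assms(1)] by (intro tcoset_eqI) (simp add: scale_add)
  qed
  have "f \<in> tcoset f" using R_zero by (force simp: tcoset_def r_coset_def)
  then have ne: "tcoset f \<noteq> {}" by blast
  have "c \<odot>\<^bsub>V\<^esub> tcoset f = (\<Union>g\<in>tcoset f. tcoset (scale c g))"
    by (simp add: tensor_module_def tcoset_def scale_def)
  also have "\<dots> = (\<Union>g\<in>tcoset f. tcoset (scale c f))"
    by (intro SUP_cong refl eq)
  also have "\<dots> = tcoset (scale c f)" by (rule SUP_const[OF ne])
  finally show ?thesis .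
qed

theorem tensor_module_vectorspace: "vectorspace K V"
proof -
  interpret T: comm_group "tensor_group M K"
    unfolding tensor_group_def
    by (rule comm_group.abelian_FactGroup[OF abelian_free_Abelian_group R_subgroup])
  have V: "carrier V = carrier (tensor_group M K)" "\<zero>\<^bsub>V\<^esub> = \<one>\<^bsub>tensor_group M K\<^esub>"
    "add V = monoid.mult (tensor_group M K)"
    by (simp_all add: tensor_module_def)
  have "abelian_group V"
    by (rule abelian_groupI) (simp_all add: V T.m_ac T.l_inv_ex)
  moreover have scale_plus: "scale (a \<oplus>\<^bsub>K\<^esub> b) f - (scale a f + scale b f) \<in> R"
    if "Poly_Mapping.keys f \<subseteq> pairs" "a \<in> carrier K" "b \<in> carrier K" for a b f
    using that(1)
  proof (induction f rule: free_Abelian_group_induct[consumes 1, case_names zero diff frag])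
    case zero
    then show ?case by (simp add: scale_zero R_zero)
  next
    case (diff f g)
    then show ?case
      using R_add[OF diff(3) R_minus[OF diff(4)]] by (simp add: scale_diff algebra_simps)
  next
    case (frag mx)
    then obtain m x where "mx = (m, x)" "m \<in> carrier M" "x \<in> carrier K" by auto
    then show ?case
      using that R_add_rel[of m "a \<otimes>\<^bsub>K\<^esub> x" "b \<otimes>\<^bsub>K\<^esub> x"]
      by (simp add: scale_of K.l_distr algebra_simps)
  qed
  moreover have scale_mult: "scale (a \<otimes>\<^bsub>K\<^esub> b) f = scale a (scale b f)"
    if "Poly_Mapping.keys f \<subseteq> pairs" "a \<in> carrier K" "b \<in> carrier K" for a b f
    using that(1)
    by (induction f rule: free_Abelian_group_induct[consumes 1, case_names zero diff frag])
      (use that in \<open>auto simp: scale_zero scale_diff scale_of K.m_assoc\<close>)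
  moreover have scale_one: "scale \<one>\<^bsub>K\<^esub> f = f" if "Poly_Mapping.keys f \<subseteq> pairs" for f
    using that
    by (induction f rule: free_Abelian_group_induct[consumes 1, case_names zero diff frag]) (auto simp: scale_zero scale_diff scale_of)
  moreover have keys_plus: "Poly_Mapping.keys (f + g) \<subseteq> pairs"
    if "Poly_Mapping.keys f \<subseteq> pairs" "Poly_Mapping.keys g \<subseteq> pairs"
    for f g :: "'m \<times> 'k \<Rightarrow>\<^sub>0 int"
    using that keys_add[of f g] by blast
  ultimately have "module K V"
  proof (intro moduleI K.cring_axioms)
    fix a v assume a: "a \<in> carrier K" and "v \<in> carrier V"
    then obtain f where f: "Poly_Mapping.keys f \<subseteq> pairs" "v = tcoset f" by (auto simp: carrier_V)
    show "a \<odot>\<^bsub>V\<^esub> v \<in> carrier V" using a f scale_keys[OF a f(1)] by (simp add: V_smult carrier_V)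
    {
      fix b assume b: "b \<in> carrier K"
      show "(a \<oplus>\<^bsub>K\<^esub> b) \<odot>\<^bsub>V\<^esub> v = a \<odot>\<^bsub>V\<^esub> v \<oplus>\<^bsub>V\<^esub> b \<odot>\<^bsub>V\<^esub> v"
        using a b f tcoset_eqI[OF scale_plus[OF f(1) a b]] by (simp add: V_smult V_add scale_keys)
      show "a \<otimes>\<^bsub>K\<^esub> b \<odot>\<^bsub>V\<^esub> v = a \<odot>\<^bsub>V\<^esub> (b \<odot>\<^bsub>V\<^esub> v)"
        using a b f scale_mult[OF f(1) a b] by (simp add: V_smult scale_keys)
    }
    fix w assume "w \<in> carrier V"
    then obtain g where g: "Poly_Mapping.keys g \<subseteq> pairs" "w = tcoset g" by (auto simp: carrier_V)
    show "a \<odot>\<^bsub>V\<^esub> (v \<oplus>\<^bsub>V\<^esub> w) = a \<odot>\<^bsub>V\<^esub> v \<oplus>\<^bsub>V\<^esub> a \<odot>\<^bsub>V\<^esub> w"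
      using a f g keys_plus[OF f(1) g(1)] by (simp add: V_smult V_add scale_keys scale_add)
  next
    fix v assume "v \<in> carrier V"
    then obtain f where f: "Poly_Mapping.keys f \<subseteq> pairs" "v = tcoset f" by (auto simp: carrier_V)
    then show "\<one>\<^bsub>K\<^esub> \<odot>\<^bsub>V\<^esub> v = v" using scale_one by (simp add: V_smult)
  qed
  then show ?thesis by (simp add: vectorspace_def K.field_axioms)
qed

lemma tensor_closed: "m \<in> carrier M \<Longrightarrow> x \<in> carrier K \<Longrightarrow> tensor m x \<in> carrier V"
  by (auto simp: carrier_V tensor_def)

lemma tensor_mult: "m \<in> carrier M \<Longrightarrow> m' \<in> carrier M \<Longrightarrow> x \<in> carrier K \<Longrightarrow>
    tensor (m \<otimes>\<^bsub>M\<^esub> m') x = tensor m x \<oplus>\<^bsub>V\<^esub> tensor m' x"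
proof -
  assume m: "m \<in> carrier M" "m' \<in> carrier M" and x: "x \<in> carrier K"
  have "frag_of (m \<otimes>\<^bsub>M\<^esub> m', x) - (frag_of (m, x) + frag_of (m', x)) \<in> R"
    using R_mult_rel[OF m x] by (simp add: diff_diff_eq)
  from tcoset_eqI[OF this] show ?thesis using m x by (simp add: tensor_def V_add)
qed

lemma tensor_smult: "m \<in> carrier M \<Longrightarrow> x \<in> carrier K \<Longrightarrow> c \<in> carrier K \<Longrightarrow>
    c \<odot>\<^bsub>V\<^esub> tensor m x = tensor m (c \<otimes>\<^bsub>K\<^esub> x)"
  by (simp add: tensor_def V_smult scale_of)

lemma tensors_span:
  assumes "submodule K U V" "\<And>m x. m \<in> carrier M \<Longrightarrow> x \<in> carrier K \<Longrightarrow> tensor m x \<in> U"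
  shows "carrier V \<subseteq> U"
proof
  interpret V: vectorspace K V by (rule tensor_module_vectorspace)
  fix v assume "v \<in> carrier V"
  then obtain f where f: "Poly_Mapping.keys f \<subseteq> pairs" "v = tcoset f" unfolding carrier_V by blast
  from f(1) have "tcoset f \<in> U"
  proof (induction f rule: free_Abelian_group_induct[consumes 1, case_names zero diff frag])
    case zero
    then show ?case using submodule.zero_closed[OF assms(1)] by (simp only: V_zero)
  next
    case (diff f g)
    have g: "tcoset g \<in> carrier V" "tcoset (- g) \<in> carrier V"
      using diff(2) unfolding carrier_V by (simp_all add: image_eqI)
    have "tcoset (- g) \<oplus>\<^bsub>V\<^esub> tcoset g = \<zero>\<^bsub>V\<^esub>" using diff(2) by (simp add: V_add V_zero)
    then have "\<ominus>\<^bsub>V\<^esub> tcoset g = tcoset (- g)" using g by (intro V.M.minus_equality)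
    then have "(\<ominus>\<^bsub>K\<^esub> \<one>\<^bsub>K\<^esub>) \<odot>\<^bsub>V\<^esub> tcoset g = tcoset (- g)" using g by (simp add: V.smult_l_minus)
    then have "tcoset (- g) \<in> U"
      using submodule.smult_closed[OF assms(1) _ diff(4), of "\<ominus>\<^bsub>K\<^esub> \<one>\<^bsub>K\<^esub>"] by simp
    then have "tcoset f \<oplus>\<^bsub>V\<^esub> tcoset (- g) \<in> U" by (rule submodule.m_closed[OF assms(1) diff(3)])
    then show ?case using diff(1,2) by (simp add: V_add)
  next
    case (frag mx)
    then show ?case using assms(2)[of "fst mx" "snd mx"] by (simp add: tensor_def mem_Times_iff)
  qed
  then show "v \<in> U" using f by simp
qed

end

section \<open>Prime fields\<close>

text \<open>
  These are the fields without proper subfields. The rank estimate rests on this common feature of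
  the rational numbers and the residue fields: a value of an additive function can be turned into an integer multiple of
  \<open>\<one>\<close> by passing to a power of the group element.
\<close>

definition prime_field :: "('k, 'c) ring_scheme \<Rightarrow> bool"
  where "prime_field K \<longleftrightarrow> (\<forall>c\<in>carrier K. \<exists>(a::int) (b::int).
      [b] \<cdot>\<^bsub>K\<^esub> \<one>\<^bsub>K\<^esub> \<noteq> \<zero>\<^bsub>K\<^esub> \<and> [b] \<cdot>\<^bsub>K\<^esub> c = [a] \<cdot>\<^bsub>K\<^esub> \<one>\<^bsub>K\<^esub>)"

lemma prime_field_iso:
  assumes "ring K" "ring L" "K \<simeq> L" "prime_field L"
  shows "prime_field K"
proof -
  obtain h where h: "h \<in> ring_hom K L" "bij_betw h (carrier K) (carrier L)"
    using assms(3) by (auto simp: is_ring_iso_def ring_iso_def)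
  interpret h: ring_hom_ring K L h using assms(1,2) h(1) by (intro ring_hom_ringI2)
  have pow: "h ([k] \<cdot>\<^bsub>K\<^esub> c) = [k] \<cdot>\<^bsub>L\<^esub> h c" if "c \<in> carrier K" for k :: int and c
  proof -
    have "h \<in> hom (add_monoid K) (add_monoid L)" by (auto intro!: homI)
    from hom_int_pow[OF this, of c k] show ?thesis
      using that h.R.a_group h.S.a_group by (simp add: add_pow_def)
  qed
  show ?thesis
    unfolding prime_field_def
  proof
    fix c assume c: "c \<in> carrier K"
    obtain a b :: int where ab: "[b] \<cdot>\<^bsub>L\<^esub> \<one>\<^bsub>L\<^esub> \<noteq> \<zero>\<^bsub>L\<^esub>" "[b] \<cdot>\<^bsub>L\<^esub> h c = [a] \<cdot>\<^bsub>L\<^esub> \<one>\<^bsub>L\<^esub>"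
      using assms(4) h.hom_closed[OF c] unfolding prime_field_def by blast
    have "h ([b] \<cdot>\<^bsub>K\<^esub> c) = h ([a] \<cdot>\<^bsub>K\<^esub> \<one>\<^bsub>K\<^esub>)" using ab(2) c by (simp add: pow)
    then have "[b] \<cdot>\<^bsub>K\<^esub> c = [a] \<cdot>\<^bsub>K\<^esub> \<one>\<^bsub>K\<^esub>"
      using c h(2) by (auto simp: bij_betw_def inj_on_def)
    moreover have "[b] \<cdot>\<^bsub>K\<^esub> \<one>\<^bsub>K\<^esub> \<noteq> \<zero>\<^bsub>K\<^esub>"
      using ab(1) pow[of "\<one>\<^bsub>K\<^esub>" b] by auto
    ultimately show "\<exists>(a::int) (b::int).
      [b] \<cdot>\<^bsub>K\<^esub> \<one>\<^bsub>K\<^esub> \<noteq> \<zero>\<^bsub>K\<^esub> \<and> [b] \<cdot>\<^bsub>K\<^esub> c = [a] \<cdot>\<^bsub>K\<^esub> \<one>\<^bsub>K\<^esub>" by blast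
  qed
qed

lemma prime_field_rat: "prime_field (ring_of_type_algebra :: rat ring)"
proof -
  define L where "L = (ring_of_type_algebra :: rat ring)"
  interpret L: ring L unfolding L_def by (rule ring_from_type_algebra)
  have L: "carrier L = UNIV" "\<one>\<^bsub>L\<^esub> = 1" "\<zero>\<^bsub>L\<^esub> = 0" "x \<oplus>\<^bsub>L\<^esub> y = x + y" for x y
    by (simp_all add: L_def ring_of_type_algebra_def)
  have neg: "\<ominus>\<^bsub>L\<^esub> x = - x" for x
    using L.minus_equality[of "- x" x] by (simp add: L)
  have nat: "[n] \<cdot>\<^bsub>L\<^esub> x = of_nat n * x" for n :: nat and x
    by (induction n) (auto simp: L algebra_simps)
  have int: "[k] \<cdot>\<^bsub>L\<^esub> x = of_int k * x" for k :: int and x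
    by (cases "k \<ge> 0") (simp_all add: add_pow_int_ge add_pow_int_lt nat neg)
  have "\<exists>(a::int) (b::int). of_int b \<noteq> (0::rat) \<and> of_int b * c = of_int a" for c :: rat
  proof -
    obtain a b where "quotient_of c = (a, b)" by force
    then have "c = of_int a / of_int b" "b > 0" using quotient_of_div quotient_of_denom_pos by auto
    then show ?thesis by (intro exI[of _ a] exI[of _ b]) auto
  qed
  then show ?thesis unfolding prime_field_def L_def[symmetric] by (simp add: int L)
qed

lemma prime_field_residue_ring:
  assumes "prime p"
  shows "prime_field (residue_ring (int p))"
proof -
  define L where "L = residue_ring (int p)"
  have p: "int p > 1" using prime_gt_1_nat[OF assms] by simp
  interpret L: residues "int p" L
    by unfold_locales (use p in \<open>auto simp: L_def\<close>)
  have L: "carrier L = {0..int p - 1}" "\<one>\<^bsub>L\<^esub> = 1" "\<zero>\<^bsub>L\<^esub> = 0" "x \<oplus>\<^bsub>L\<^esub> y = (x + y) mod int p" for x y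
    by (simp_all add: L_def residue_ring_def)
  have nat: "[n] \<cdot>\<^bsub>L\<^esub> \<one>\<^bsub>L\<^esub> = int n mod int p" for n :: nat
    by (induction n) (simp_all add: L mod_simps add_ac)
  show ?thesis
    unfolding prime_field_def L_def[symmetric]
  proof
    fix c assume c: "c \<in> carrier L"
    have "add_pow L (1::int) \<one>\<^bsub>L\<^esub> \<noteq> \<zero>\<^bsub>L\<^esub>" "add_pow L (1::int) c = c"
      using c p L.add.int_pow_1[of c] L.add.int_pow_1[of "\<one>\<^bsub>L\<^esub>"] by (simp_all add: L(1-3))
    moreover have "add_pow L c \<one>\<^bsub>L\<^esub> = c"
      using c nat[of "nat c"] by (simp add: add_pow_int_ge L(1))
    ultimately show "\<exists>(a::int) (b::int).
      [b] \<cdot>\<^bsub>L\<^esub> \<one>\<^bsub>L\<^esub> \<noteq> \<zero>\<^bsub>L\<^esub> \<and> [b] \<cdot>\<^bsub>L\<^esub> c = [a] \<cdot>\<^bsub>L\<^esub> \<one>\<^bsub>L\<^esub>"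
      by metis
  qed
qed

section \<open>Triangular systems and the rank of a section\<close>

context field_and_group
begin

abbreviation D :: "nat \<Rightarrow> 'g set"
  where "D n \<equiv> dimension_subgroup K G n"

lemma D_carrier: "g \<in> D n \<Longrightarrow> g \<in> carrier G"
  by (simp add: dimension_subgroup_iff_poly_fun)

text \<open>
  Left translates of \<open>\<phi>\<close> have the same degree, so \<open>g\<close> is invisible to them too.
\<close>

lemma D_invisible:
  assumes "g \<in> D n" "poly_fun n \<phi>" "u \<in> carrier G"
  shows "\<phi> (u \<otimes>\<^bsub>G\<^esub> g) = \<phi> u"
proof -
  have "\<psi> g = \<psi> \<one>\<^bsub>G\<^esub>" if "poly_fun n \<psi>" for \<psi>
    using assms(1) that by (simp add: dimension_subgroup_iff_poly_fun)
  from this[OF poly_fun_left_translate[OF assms(2,3)]] show ?thesis using assms(3) by simp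
qed

lemma D_subgroup: "subgroup (D n) G"
proof (rule G.subgroupI)
  show "D n \<subseteq> carrier G" using D_carrier by blast
  have "\<one>\<^bsub>G\<^esub> \<in> D n" by (simp add: dimension_subgroup_iff_poly_fun)
  then show "D n \<noteq> {}" by blast
  fix g assume g: "g \<in> D n"
  note gG = D_carrier[OF g]
  show "inv\<^bsub>G\<^esub> g \<in> D n"
  proof -
    have "\<phi> (inv\<^bsub>G\<^esub> g) = \<phi> \<one>\<^bsub>G\<^esub>" if "poly_fun n \<phi>" for \<phi>
      using D_invisible[OF g that, of "inv\<^bsub>G\<^esub> g"] gG by simp
    then show ?thesis using gG by (simp add: dimension_subgroup_iff_poly_fun)
  qed
  fix h assume h: "h \<in> D n"
  note hG = D_carrier[OF h]
  show "g \<otimes>\<^bsub>G\<^esub> h \<in> D n"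
  proof -
    have "\<phi> (g \<otimes>\<^bsub>G\<^esub> h) = \<phi> \<one>\<^bsub>G\<^esub>" if "poly_fun n \<phi>" for \<phi>
      using D_invisible[OF h that gG] D_invisible[OF g that G.one_closed] gG by simp
    then show ?thesis using gG hG by (simp add: dimension_subgroup_iff_poly_fun)
  qed
qed

lemma D_normal: "D n \<lhd> G"
proof (rule G.normal_invI[OF D_subgroup])
  fix x g assume x: "x \<in> carrier G" and g: "g \<in> D n"
  have "\<phi> (x \<otimes>\<^bsub>G\<^esub> g \<otimes>\<^bsub>G\<^esub> inv\<^bsub>G\<^esub> x) = \<phi> \<one>\<^bsub>G\<^esub>" if "poly_fun n \<phi>" for \<phi>
    using D_invisible[OF g poly_fun_right_translate[OF that, of "inv\<^bsub>G\<^esub> x"] x] x by simp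
  then show "x \<otimes>\<^bsub>G\<^esub> g \<otimes>\<^bsub>G\<^esub> inv\<^bsub>G\<^esub> x \<in> D n"
    using x D_carrier[OF g] by (simp add: dimension_subgroup_iff_poly_fun)
qed

lemma D_antimono: "m \<le> n \<Longrightarrow> D n \<subseteq> D m"
  using poly_fun_mono by (auto simp: dimension_subgroup_iff_poly_fun)

text \<open>
  The left difference of \<open>\<phi>\<close> along \<open>u\<close> has smaller degree, hence takes the same value at \<open>g\<close> and at
  \<open>\<one>\<close>.
\<close>

lemma D_additive:
  assumes g: "g \<in> D n" and \<phi>: "poly_fun (Suc n) \<phi>" "\<phi> \<one>\<^bsub>G\<^esub> = \<zero>\<^bsub>K\<^esub>" and u: "u \<in> carrier G"
  shows "\<phi> (u \<otimes>\<^bsub>G\<^esub> g) = \<phi> u \<oplus>\<^bsub>K\<^esub> \<phi> g"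
proof -
  have gG: "g \<in> carrier G" by (rule D_carrier[OF g])
  have c: "\<phi> (u \<otimes>\<^bsub>G\<^esub> g) \<in> carrier K" "\<phi> u \<in> carrier K" "\<phi> g \<in> carrier K"
    using poly_fun_closed[OF \<phi>(1)] u gG by auto
  have "\<phi> (u \<otimes>\<^bsub>G\<^esub> g) \<ominus>\<^bsub>K\<^esub> \<phi> g = \<phi> (u \<otimes>\<^bsub>G\<^esub> \<one>\<^bsub>G\<^esub>) \<ominus>\<^bsub>K\<^esub> \<phi> \<one>\<^bsub>G\<^esub>"
  proof -
    have "\<psi> g = \<psi> \<one>\<^bsub>G\<^esub>" if "poly_fun n \<psi>" for \<psi>
      using g that by (simp add: dimension_subgroup_iff_poly_fun)
    from this[OF left_diff_poly_fun[OF \<phi>(1) u]] show ?thesis .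
  qed
  then have "\<phi> (u \<otimes>\<^bsub>G\<^esub> g) \<ominus>\<^bsub>K\<^esub> \<phi> g = \<phi> u" using c \<phi> u by (simp add: K.minus_eq)
  then have "\<phi> (u \<otimes>\<^bsub>G\<^esub> g) = \<phi> u \<oplus>\<^bsub>K\<^esub> \<phi> g"
    using c by (metis K.add.inv_closed K.a_assoc K.l_neg K.minus_eq K.r_zero)
  then show ?thesis .
qed

text \<open>
  A finite family of elements of \<open>D n\<close> together with normalised functions of degree at most \<open>n\<close>
  whose matrix of values is unitriangular. With a triangular rather than a diagonal matrix a system
  can be extended without changing its earlier members.
\<close>

definition triangular_system ::
  "nat \<Rightarrow> nat \<Rightarrow> (nat \<Rightarrow> 'g) \<Rightarrow> (nat \<Rightarrow> 'g \<Rightarrow> 'k) \<Rightarrow> bool"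
  where "triangular_system n r g \<phi> \<longleftrightarrow> (\<forall>i<r. g i \<in> D n \<and> poly_fun (Suc n) (\<phi> i) \<and>
    \<phi> i \<one>\<^bsub>G\<^esub> = \<zero>\<^bsub>K\<^esub> \<and> \<phi> i (g i) = \<one>\<^bsub>K\<^esub> \<and> (\<forall>j<r. i < j \<longrightarrow> \<phi> i (g j) = \<zero>\<^bsub>K\<^esub>))"

text \<open>
  Since \<open>h \<notin> D (Suc n)\<close>, some function of degree at most \<open>n\<close> distinguishes \<open>h\<close> from \<open>\<one>\<close>; after
  normalisation it is the new diagonal entry.
\<close>

lemma triangular_system_extend:
  assumes sys: "triangular_system n r g \<phi>"
    and h: "h \<in> D n" "h \<notin> D (Suc n)" and van: "\<And>i. i < r \<Longrightarrow> \<phi> i h = \<zero>\<^bsub>K\<^esub>"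
  shows "\<exists>g' \<phi>'. triangular_system n (Suc r) g' \<phi>'"
proof -
  have hG: "h \<in> carrier G" by (rule D_carrier[OF h(1)])
  obtain \<psi> where \<psi>: "poly_fun (Suc n) \<psi>" "\<psi> h \<noteq> \<psi> \<one>\<^bsub>G\<^esub>"
    using h(2) hG unfolding dimension_subgroup_iff_poly_fun by blast
  have c: "\<psi> h \<in> carrier K" "\<psi> \<one>\<^bsub>G\<^esub> \<in> carrier K" using poly_fun_closed[OF \<psi>(1)] hG by auto
  define e where "e = \<psi> h \<ominus>\<^bsub>K\<^esub> \<psi> \<one>\<^bsub>G\<^esub>"
  have e: "e \<in> carrier K" "e \<noteq> \<zero>\<^bsub>K\<^esub>" using c \<psi>(2) K.r_right_minus_eq by (auto simp: e_def)
  then have ie: "inv\<^bsub>K\<^esub> e \<in> carrier K" "inv\<^bsub>K\<^esub> e \<otimes>\<^bsub>K\<^esub> e = \<one>\<^bsub>K\<^esub>"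
    using K.field_Units K.Units_inv_closed K.Units_l_inv by auto
  define \<chi> where "\<chi> = (\<lambda>x. inv\<^bsub>K\<^esub> e \<otimes>\<^bsub>K\<^esub> (\<psi> x \<ominus>\<^bsub>K\<^esub> \<psi> \<one>\<^bsub>G\<^esub>))"
  have \<chi>: "poly_fun (Suc n) \<chi>"
    unfolding \<chi>_def by (intro poly_fun_smult poly_fun_diff poly_fun_const \<psi> ie c)
  have \<chi>1: "\<chi> \<one>\<^bsub>G\<^esub> = \<zero>\<^bsub>K\<^esub>" "\<chi> h = \<one>\<^bsub>K\<^esub>"
    using c ie by (auto simp: \<chi>_def e_def K.minus_eq K.r_neg)
  have "triangular_system n (Suc r) (g(r := h)) (\<phi>(r := \<chi>))"
    using sys \<chi> \<chi>1 h(1) van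
    by (auto simp: triangular_system_def less_Suc_eq simp del: poly_fun.simps)
  then show ?thesis by blast
qed

text \<open>
  The tensors \<open>g\<^sub>i \<otimes> 1\<close> of a maximal triangular system span the tensor product. By maximality, an
  element of \<open>D n\<close> at which all \<open>\<phi> i\<close> vanish lies in \<open>D (Suc n)\<close> and gives the zero tensor. If
  \<open>\<phi> j\<close> is the first function that does not vanish at \<open>h\<close>, then over a prime field \<open>b \<phi>\<^sub>j(h) = a\<close> with
  integers \<open>a\<close> and \<open>b\<close>, where \<open>b\<close> is invertible in \<open>K\<close>.
  All functions up to \<open>\<phi> j\<close> then vanish at the product of \<open>h\<^sup>b\<close> with the \<open>(- a)\<close>-th power of \<open>g\<^sub>j\<close>.
  The tensor of that product lies in the span by induction, and dividing by \<open>b\<close> one finds that the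
  tensor of \<open>h\<close> does, too.
\<close>

theorem dimension_rank_le:
  assumes prime_field: "prime_field K"
    and sys: "triangular_system n r g \<phi>"
    and max: "\<nexists>g' \<phi>'. triangular_system n (Suc r) g' \<phi>'"
  shows "dimension_rank K G n \<le> r"
proof -
  define N where "N = D (Suc n)"
  define H where "H = G\<lparr>carrier := D n\<rparr>"
  interpret H: group H unfolding H_def by (rule subgroup.subgroup_is_group[OF D_subgroup G.group_axioms])
  have HD: "carrier H = D n" "\<And>x y. x \<otimes>\<^bsub>H\<^esub> y = x \<otimes>\<^bsub>G\<^esub> y" by (simp_all add: H_def)
  interpret N: normal N H
    unfolding N_def H_def
    by (rule G.normal_restrict_supergroup[OF D_subgroup D_normal D_antimono]) simp
  define M where "M = H Mod N"
  interpret M: group M unfolding M_def by (rule N.factorgroup_is_group)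
  interpret T: tensor_with_field K M ..
  interpret V: vectorspace K "tensor_module M K" by (rule T.tensor_module_vectorspace)
  define V where "V = tensor_module M K"
  define q where "q h = N #>\<^bsub>H\<^esub> h" for h
  have q: "q h \<in> carrier M" if "h \<in> D n" for h
    using that by (auto simp: q_def M_def FactGroup_def RCOSETS_def HD)
  have qmult: "q (h \<otimes>\<^bsub>H\<^esub> h') = q h \<otimes>\<^bsub>M\<^esub> q h'" if "h \<in> D n" "h' \<in> D n" for h h'
    using N.rcos_sum[of h h'] that by (simp add: q_def M_def FactGroup_def HD)
  define t where "t x h = T.tensor (q h) x" for x h
  have V_grp: "group (add_monoid V)" unfolding V_def by (rule V.M.a_group)
  have t_hom: "t x \<in> hom H (add_monoid V)" if "x \<in> carrier K" for x
    using that q by (intro homI) (auto simp: t_def HD(1) V_def T.tensor_closed qmult T.tensor_mult)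
  have t_closed: "t x h \<in> carrier V" if "x \<in> carrier K" "h \<in> D n" for x h
    using that q by (auto simp: t_def V_def T.tensor_closed)
  have add_pow_V: "[k] \<cdot>\<^bsub>V\<^esub> v = ([k] \<cdot>\<^bsub>K\<^esub> \<one>\<^bsub>K\<^esub>) \<odot>\<^bsub>V\<^esub> v" if "v \<in> carrier V" for k :: int and v
  proof -
    have "(\<lambda>c. c \<odot>\<^bsub>V\<^esub> v) \<in> hom (add_monoid K) (add_monoid V)"
      using that by (intro homI) (auto simp: V_def V.smult_l_distr)
    from hom_int_pow[OF this, of "\<one>\<^bsub>K\<^esub>" k] show ?thesis
      using V_grp K.a_group that by (simp add: add_pow_def V_def)
  qed
  have gD: "g i \<in> D n" if "i < r" for i using sys that by (auto simp: triangular_system_def)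
  define S where "S = (\<lambda>i. t \<one>\<^bsub>K\<^esub> (g i)) ` {..<r}"
  have SV: "S \<subseteq> carrier V" "finite S" using t_closed gD by (auto simp: S_def)
  define U where "U = V.span S"
  have U: "submodule K U V" unfolding U_def V_def using SV by (intro V.span_is_submodule) (simp add: V_def)
  have Uadd: "v \<oplus>\<^bsub>V\<^esub> w \<in> U" if "v \<in> U" "w \<in> U" for v w using that U by (auto simp: submodule_def)
  have Usm: "c \<odot>\<^bsub>V\<^esub> v \<in> U" if "c \<in> carrier K" "v \<in> U" for c v using that U by (auto simp: submodule_def)
  have UV: "v \<in> carrier V" if "v \<in> U" for v using that U by (auto simp: submodule_def)
  have Usub: "v \<in> U" if vw: "v \<oplus>\<^bsub>V\<^esub> w \<in> U" "w \<in> U" "v \<in> carrier V" for v w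
  proof -
    have w: "w \<in> carrier V" by (rule UV[OF vw(2)])
    have "(v \<oplus>\<^bsub>V\<^esub> w) \<oplus>\<^bsub>V\<^esub> (\<ominus>\<^bsub>K\<^esub> \<one>\<^bsub>K\<^esub>) \<odot>\<^bsub>V\<^esub> w = v"
      using vw(3) w by (simp add: V_def V.smult_l_minus V.M.a_assoc V.M.r_neg)
    moreover have "(\<ominus>\<^bsub>K\<^esub> \<one>\<^bsub>K\<^esub>) \<odot>\<^bsub>V\<^esub> w \<in> U" using Usm vw by simp
    ultimately show ?thesis using Uadd vw(1) by metis
  qed
  have gU: "t x (g i) \<in> U" if "i < r" "x \<in> carrier K" for i x
  proof -
    have "t \<one>\<^bsub>K\<^esub> (g i) \<in> U"
      using V.in_own_span[of S] SV that unfolding U_def S_def V_def by blast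
    then have "x \<odot>\<^bsub>V\<^esub> t \<one>\<^bsub>K\<^esub> (g i) \<in> U" using Usm that by blast
    then show ?thesis using that q gD by (simp add: t_def V_def T.tensor_smult)
  qed
  have \<phi>_hom: "\<phi> i \<in> hom H (add_monoid K)" if "i < r" for i
    using sys that by (intro homI)
      (auto simp: triangular_system_def HD D_additive D_carrier intro: poly_fun_closed
            simp del: poly_fun.simps)
  \<comment> \<open>The more of the functions vanish at \<open>h\<close>, the easier the claim; hence downward induction on \<open>j\<close>.\<close>
  have main: "\<forall>x\<in>carrier K. t x h \<in> U"
    if "j \<le> r" "h \<in> D n" "\<And>i. i < j \<Longrightarrow> \<phi> i h = \<zero>\<^bsub>K\<^esub>" for j h
    using that
  proof (induction j arbitrary: h rule: inc_induct)
    case base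
    have "h \<in> D (Suc n)"
      using triangular_system_extend[OF sys] base max by blast
    then have "q h = \<one>\<^bsub>M\<^esub>"
      using N.subgroup_axioms by (simp add: q_def M_def FactGroup_def N_def H.coset_join2 HD base)
    then have "q h \<otimes>\<^bsub>M\<^esub> q h = q h" by simp
    show ?case
    proof
      fix x assume x: "x \<in> carrier K"
      have "t x h \<oplus>\<^bsub>V\<^esub> t x h = t x h"
        using T.tensor_mult[OF q q, of h h x] base x \<open>q h \<otimes>\<^bsub>M\<^esub> q h = q h\<close>
        by (simp add: t_def V_def)
      then have "t x h = \<zero>\<^bsub>V\<^esub>"
        using t_closed[OF x base(1)] V.M.add.r_cancel_one[of "t x h" "t x h"] by (simp add: V_def)
      then show "t x h \<in> U" using U by (simp add: submodule_def)
    qed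
  next
    case (step j)
    have h: "h \<in> D n" by fact
    have \<phi>h: "\<phi> j h \<in> carrier K" using \<phi>_hom[OF step(2)] h by (auto simp: hom_def HD)
    then obtain a b :: int where b: "[b] \<cdot>\<^bsub>K\<^esub> \<one>\<^bsub>K\<^esub> \<noteq> \<zero>\<^bsub>K\<^esub>" and ab: "[b] \<cdot>\<^bsub>K\<^esub> \<phi> j h = [a] \<cdot>\<^bsub>K\<^esub> \<one>\<^bsub>K\<^esub>"
      using prime_field unfolding prime_field_def by blast
    define h' where "h' = h [^]\<^bsub>H\<^esub> b \<otimes>\<^bsub>H\<^esub> g j [^]\<^bsub>H\<^esub> (- a)"
    have hp: "h [^]\<^bsub>H\<^esub> b \<in> D n" and gp: "g j [^]\<^bsub>H\<^esub> (- a) \<in> D n"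
      using H.int_pow_closed h gD[OF step(2)] by (simp_all add: HD)
    have h'D: "h' \<in> D n" using H.m_closed hp gp by (simp add: h'_def HD)
    have \<phi>h': "\<phi> i h' = add_pow K b (\<phi> i h) \<oplus>\<^bsub>K\<^esub> add_pow K (- a) (\<phi> i (g j))" if "i < r" for i
      using hom_mult[OF \<phi>_hom[OF that], of "h [^]\<^bsub>H\<^esub> b" "g j [^]\<^bsub>H\<^esub> (- a)"] hp gp
        hom_int_pow[OF \<phi>_hom[OF that], of h b] hom_int_pow[OF \<phi>_hom[OF that], of "g j" "- a"]
        h gD[OF step(2)] H.group_axioms K.a_group
      by (simp add: h'_def HD(1) add_pow_def)
    have "\<phi> i h' = \<zero>\<^bsub>K\<^esub>" if "i < Suc j" for i
    proof (cases "i = j")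
      case True
      have "\<phi> j (g j) = \<one>\<^bsub>K\<^esub>" using sys step(2) by (auto simp: triangular_system_def)
      then show ?thesis
        using True \<phi>h'[OF step(2)] ab K.add.int_pow_neg[of "\<one>\<^bsub>K\<^esub>" a] by (simp add: K.r_neg)
    next
      case False
      then have "i < j" using that by simp
      then have "\<phi> i h = \<zero>\<^bsub>K\<^esub>" "\<phi> i (g j) = \<zero>\<^bsub>K\<^esub>"
        using step sys by (auto simp: triangular_system_def)
      then show ?thesis using \<phi>h'[of i] \<open>i < j\<close> step(2) K.add.int_pow_one by simp
    qed
    then have h'U: "t x h' \<in> U" if "x \<in> carrier K" for x
      using step.IH[OF h'D] that by blast
    show ?case
    proof
      fix x assume x: "x \<in> carrier K"
      define \<beta> where "\<beta> = [b] \<cdot>\<^bsub>K\<^esub> \<one>\<^bsub>K\<^esub>"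
      have \<beta>: "\<beta> \<in> carrier K" "\<beta> \<noteq> \<zero>\<^bsub>K\<^esub>" using b by (auto simp: \<beta>_def)
      then have i\<beta>: "inv\<^bsub>K\<^esub> \<beta> \<in> carrier K" "inv\<^bsub>K\<^esub> \<beta> \<otimes>\<^bsub>K\<^esub> \<beta> = \<one>\<^bsub>K\<^esub>"
        using K.field_Units K.Units_inv_closed K.Units_l_inv by auto
      have th: "t x h \<in> carrier V" "t x (g j) \<in> carrier V"
        using t_closed[OF x] h gD[OF step(2)] by auto
      have "t x h' = add_pow V b (t x h) \<oplus>\<^bsub>V\<^esub> add_pow V (- a) (t x (g j))"
        using hom_mult[OF t_hom[OF x], of "h [^]\<^bsub>H\<^esub> b" "g j [^]\<^bsub>H\<^esub> (- a)"] hp gp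
          hom_int_pow[OF t_hom[OF x], of h b] hom_int_pow[OF t_hom[OF x], of "g j" "- a"]
          h gD[OF step(2)] H.group_axioms V_grp
        by (simp add: h'_def HD(1) add_pow_def)
      also have "\<dots> = \<beta> \<odot>\<^bsub>V\<^esub> t x h \<oplus>\<^bsub>V\<^esub> (add_pow K (- a) \<one>\<^bsub>K\<^esub>) \<odot>\<^bsub>V\<^esub> t x (g j)"
        using th by (simp add: add_pow_V \<beta>_def)
      finally have "\<beta> \<odot>\<^bsub>V\<^esub> t x h \<oplus>\<^bsub>V\<^esub> (add_pow K (- a) \<one>\<^bsub>K\<^esub>) \<odot>\<^bsub>V\<^esub> t x (g j) \<in> U"
        using h'U[OF x] by simp
      moreover have "(add_pow K (- a) \<one>\<^bsub>K\<^esub>) \<odot>\<^bsub>V\<^esub> t x (g j) \<in> U"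
        using Usm[OF _ gU[OF step(2) x]] by simp
      ultimately have "\<beta> \<odot>\<^bsub>V\<^esub> t x h \<in> U" using Usub \<beta> th by (simp add: V_def)
      then have "inv\<^bsub>K\<^esub> \<beta> \<odot>\<^bsub>V\<^esub> (\<beta> \<odot>\<^bsub>V\<^esub> t x h) \<in> U" using Usm i\<beta> by blast
      then show "t x h \<in> U"
        using i\<beta> \<beta> th by (simp add: V_def V.smult_assoc1[symmetric])
    qed
  qed
  have "carrier V \<subseteq> U"
    unfolding V_def
  proof (rule T.tensors_span[OF U[unfolded V_def]])
    fix m x assume m: "m \<in> carrier M" and x: "x \<in> carrier K"
    then obtain h where h: "h \<in> D n" "m = q h"
      by (auto simp: M_def FactGroup_def RCOSETS_def q_def HD)
    then show "T.tensor m x \<in> U" using main[of 0 h] x by (simp add: t_def)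
  qed
  then have "V.span S = carrier (tensor_module M K)" using UV by (auto simp: U_def V_def)
  then have "V.dim \<le> card S" using SV V.gen_ge_dim[of S] by (simp add: V_def)
  also have "\<dots> \<le> r" using card_image_le[of "{..<r}" "\<lambda>i. t \<one>\<^bsub>K\<^esub> (g i)"] by (simp add: S_def)
  finally show ?thesis
    by (simp add: dimension_rank_def abelian_rank_def M_def H_def N_def)
qed

lemma triangular_system_exists:
  assumes "prime_field K"
  shows "r \<le> dimension_rank K G n \<Longrightarrow> \<exists>g \<phi>. triangular_system n r g \<phi>"
proof (induction r)
  case 0
  then show ?case by (auto simp: triangular_system_def)
next
  case (Suc r)
  then obtain g \<phi> where "triangular_system n r g \<phi>" by auto
  then show ?case using dimension_rank_le[OF assms, of n r g \<phi>] Suc.prems by fastforce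
qed

end

section \<open>Homogeneous linear systems\<close>

text \<open>
  Elimination: an unknown \<open>k\<close> that occurs in the equation \<open>e\<close> is used to clear \<open>e\<close>, and the remaining
  equations in the remaining unknowns are solved by induction.
\<close>

lemma (in field) homogeneous_system_solution:
  assumes "finite E"
  shows "finite I \<Longrightarrow> card E < card I \<Longrightarrow> (\<And>e i. e \<in> E \<Longrightarrow> i \<in> I \<Longrightarrow> a e i \<in> carrier R) \<Longrightarrow>
    \<exists>c. c \<in> I \<rightarrow> carrier R \<and> (\<exists>i\<in>I. c i \<noteq> \<zero>) \<and> (\<forall>e\<in>E. (\<Oplus>i\<in>I. c i \<otimes> a e i) = \<zero>)"
  using assms
proof (induction E arbitrary: I a rule: finite_induct)
  case empty
  then have "I \<noteq> {}" by auto
  then show ?case by (intro exI[of _ "\<lambda>_. \<one>"]) auto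
next
  case (insert e E)
  have cE: "card E < card I" using insert by simp
  have aI: "a e' i \<in> carrier R" if "e' \<in> insert e E" "i \<in> I" for e' i
    using insert.prems(3) that by blast
  show ?case
  proof (cases "\<forall>i\<in>I. a e i = \<zero>")
    case True
    obtain c where c: "c \<in> I \<rightarrow> carrier R" "\<exists>i\<in>I. c i \<noteq> \<zero>" "\<forall>e\<in>E. (\<Oplus>i\<in>I. c i \<otimes> a e i) = \<zero>"
      using insert.IH[OF insert.prems(1) cE, of a] aI by blast
    have "(\<Oplus>i\<in>I. c i \<otimes> a e i) = \<zero>"
      using True c(1) by (intro add.finprod_one_eqI) (auto simp: Pi_iff)
    then show ?thesis using c by blast
  next
    case False
    then obtain k where k: "k \<in> I" "a e k \<noteq> \<zero>" by blast
    define p where "p = a e k"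
    have p: "p \<in> carrier R" "p \<noteq> \<zero>" using k aI by (auto simp: p_def)
    then have ip: "inv p \<in> carrier R" "inv p \<otimes> p = \<one>"
      using field_Units Units_inv_closed Units_l_inv by auto
    define J where "J = I - {k}"
    have J: "finite J" "card E < card J" "I = insert k J" "k \<notin> J"
      using insert.prems insert.hyps k by (auto simp: J_def card_Diff_singleton)
    define r where "r e' = \<ominus> (a e' k \<otimes> inv p)" for e'
    have r: "r e' \<in> carrier R" if "e' \<in> E" for e' using that aI k ip by (auto simp: r_def)
    have cl: "a e' i \<oplus> r e' \<otimes> a e i \<in> carrier R" if "e' \<in> E" "i \<in> J" for e' i
      using that aI[of e' i] aI[of e i] r[of e'] J(3) by simp
    have "\<exists>c. c \<in> J \<rightarrow> carrier R \<and> (\<exists>i\<in>J. c i \<noteq> \<zero>) \<and>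
        (\<forall>e'\<in>E. (\<Oplus>i\<in>J. c i \<otimes> (a e' i \<oplus> r e' \<otimes> a e i)) = \<zero>)"
      by (rule insert.IH[OF J(1,2)]) (rule cl)
    then obtain c where c: "c \<in> J \<rightarrow> carrier R" "\<exists>i\<in>J. c i \<noteq> \<zero>"
        "\<forall>e'\<in>E. (\<Oplus>i\<in>J. c i \<otimes> (a e' i \<oplus> r e' \<otimes> a e i)) = \<zero>"
      by (elim exE conjE)
    have cJ: "c i \<in> carrier R" "a e i \<in> carrier R" if "i \<in> J" for i
      using that c aI J by auto
    define s where "s = (\<Oplus>i\<in>J. c i \<otimes> a e i)"
    have s: "s \<in> carrier R" unfolding s_def using cJ by (intro finsum_closed) auto
    define c' where "c' = c(k := \<ominus> (inv p \<otimes> s))"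
    have split: "(\<Oplus>i\<in>I. c' i \<otimes> a e' i) = c' k \<otimes> a e' k \<oplus> (\<Oplus>i\<in>J. c i \<otimes> a e' i)"
      if e': "e' \<in> insert e E" for e'
    proof -
      have "(\<Oplus>i\<in>I. c' i \<otimes> a e' i) = c' k \<otimes> a e' k \<oplus> (\<Oplus>i\<in>J. c' i \<otimes> a e' i)"
        unfolding J(3) using J cJ aI[OF e'] ip s
        by (intro finsum_insert) (auto simp: c'_def)
      also have "(\<Oplus>i\<in>J. c' i \<otimes> a e' i) = (\<Oplus>i\<in>J. c i \<otimes> a e' i)"
        using cJ aI[OF e'] J by (intro finsum_cong') (auto simp: c'_def)
      finally show ?thesis .
    qed
    have ck: "c' k = \<ominus> (inv p \<otimes> s)" by (simp add: c'_def)
    have "(\<Oplus>i\<in>I. c' i \<otimes> a e i) = \<zero>"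
    proof -
      have "(\<Oplus>i\<in>I. c' i \<otimes> a e i) = \<ominus> (inv p \<otimes> s) \<otimes> p \<oplus> s"
        using split[of e] by (simp add: ck s_def p_def)
      also have "\<ominus> (inv p \<otimes> s) \<otimes> p = \<ominus> (s \<otimes> (inv p \<otimes> p))"
        using ip(1) p(1) s by (simp add: l_minus m_comm[of "inv p" s] m_assoc)
      finally show ?thesis using ip(2) s by (simp add: l_neg)
    qed
    moreover have "(\<Oplus>i\<in>I. c' i \<otimes> a e' i) = \<zero>" if e': "e' \<in> E" for e'
    proof -
      have ae': "a e' i \<in> carrier R" if "i \<in> I" for i using aI e' that by blast
      have "\<zero> = (\<Oplus>i\<in>J. c i \<otimes> (a e' i \<oplus> r e' \<otimes> a e i))" using c(3) e' by simp
      also have "\<dots> = (\<Oplus>i\<in>J. c i \<otimes> a e' i \<oplus> r e' \<otimes> (c i \<otimes> a e i))"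
        using cJ ae' J(3) r[OF e'] by (intro finsum_cong') (auto simp: r_distr m_ac)
      also have "\<dots> = (\<Oplus>i\<in>J. c i \<otimes> a e' i) \<oplus> (\<Oplus>i\<in>J. r e' \<otimes> (c i \<otimes> a e i))"
        using cJ ae' J(3) r[OF e'] by (intro finsum_addf) auto
      also have "(\<Oplus>i\<in>J. r e' \<otimes> (c i \<otimes> a e i)) = r e' \<otimes> s"
        unfolding s_def using cJ r[OF e'] J by (intro finsum_rdistr[symmetric]) auto
      also have "r e' \<otimes> s = c' k \<otimes> a e' k"
        using ip s ae'[OF k(1)] by (simp add: r_def ck l_minus r_minus m_ac)
      also have "(\<Oplus>i\<in>J. c i \<otimes> a e' i) \<oplus> c' k \<otimes> a e' k = (\<Oplus>i\<in>I. c' i \<otimes> a e' i)"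
        unfolding split[of e', OF insertI2[OF e']] using cJ ae' J(3) ip s k
        by (intro a_comm finsum_closed) (auto simp: ck)
      finally show ?thesis by simp
    qed
    moreover have "c' \<in> I \<rightarrow> carrier R" using cJ ip s by (auto simp: c'_def J(3))
    moreover have "\<exists>i\<in>I. c' i \<noteq> \<zero>" using c(2) J by (auto simp: c'_def)
    ultimately show ?thesis by blast
  qed
qed

section \<open>Products of polynomial functions and growth\<close>

context field_and_group
begin

text \<open>
  Right multiplication by the last element \<open>g\<close> adds \<open>1\<close> to the last function and leaves the other
  functions alone. If a combination \<open>A + \<phi> B\<close> vanishes, where \<open>\<phi>\<close> is the last function and \<open>A\<close>, \<open>B\<close>
  are combinations of monomials in the others, then so does its difference along \<open>g\<close>, which is \<open>B\<close>.
  Induction gives the vanishing of the coefficients of \<open>B\<close>, and then of those of \<open>A\<close>.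
\<close>

lemma monomials_independent:
  fixes L :: nat
  assumes "\<And>i. i < L \<Longrightarrow> \<phi> i \<in> carrier G \<rightarrow> carrier K" "\<And>i. i < L \<Longrightarrow> g i \<in> carrier G"
    and "\<And>i u. i < L \<Longrightarrow> u \<in> carrier G \<Longrightarrow> \<phi> i (u \<otimes>\<^bsub>G\<^esub> g i) = \<phi> i u \<oplus>\<^bsub>K\<^esub> \<one>\<^bsub>K\<^esub>"
    and "\<And>i j u. i < j \<Longrightarrow> j < L \<Longrightarrow> u \<in> carrier G \<Longrightarrow> \<phi> i (u \<otimes>\<^bsub>G\<^esub> g j) = \<phi> i u"
  shows "c \<in> Pow {..<L} \<rightarrow> carrier K \<Longrightarrow>
    (\<And>x. x \<in> carrier G \<Longrightarrow>
      (\<Oplus>\<^bsub>K\<^esub>T\<in>Pow {..<L}. c T \<otimes>\<^bsub>K\<^esub> (\<Otimes>\<^bsub>K\<^esub>i\<in>T. \<phi> i x)) = \<zero>\<^bsub>K\<^esub>) \<Longrightarrow>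
    T \<subseteq> {..<L} \<Longrightarrow> c T = \<zero>\<^bsub>K\<^esub>"
  using assms
proof (induction L arbitrary: c T)
  case 0
  then show ?case using "0.prems"(2)[OF G.one_closed] by (simp add: Pi_iff)
next
  case (Suc L)
  define P where "P = Pow {..<L}"
  define m where "m T x = (\<Otimes>\<^bsub>K\<^esub>i\<in>T. \<phi> i x)" for T x
  define c1 where "c1 T = c (insert L T)" for T
  define A B where "A x = (\<Oplus>\<^bsub>K\<^esub>T\<in>P. c T \<otimes>\<^bsub>K\<^esub> m T x)" and "B x = (\<Oplus>\<^bsub>K\<^esub>T\<in>P. c1 T \<otimes>\<^bsub>K\<^esub> m T x)" for x
  have P: "finite P" by (simp add: P_def)
  have Pow_Suc: "Pow {..<Suc L} = P \<union> insert L ` P"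
    by (simp add: P_def lessThan_Suc Pow_insert)
  have disj: "P \<inter> insert L ` P = {}" by (auto simp: P_def)
  have inj: "inj_on (insert L) P" by (auto simp: P_def inj_on_def)
  have TP: "finite T" "L \<notin> T" "insert L T \<in> Pow {..<Suc L}" "T \<in> Pow {..<Suc L}"
    if "T \<in> P" for T
    using that finite_subset[of T "{..<L}"] by (auto simp: P_def)
  have \<phi>: "\<phi> i x \<in> carrier K" if "i < Suc L" "x \<in> carrier G" for i x
    using Suc.prems(4)[OF that(1)] that by auto
  have m: "m T x \<in> carrier K" if "T \<in> Pow {..<Suc L}" "x \<in> carrier G" for T x
    unfolding m_def using that by (intro K.finprod_closed) (auto intro!: \<phi>)
  have c: "c T \<in> carrier K" if "T \<in> Pow {..<Suc L}" for T using that Suc.prems(1) by auto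
  have c1: "c1 T \<in> carrier K" if "T \<in> P" for T using c[OF TP(3)[OF that]] by (simp add: c1_def)
  have AB: "A x \<in> carrier K" "B x \<in> carrier K" if "x \<in> carrier G" for x
    unfolding A_def B_def using that c c1 m TP by (auto intro!: K.finsum_closed)
  have decomp: "A x \<oplus>\<^bsub>K\<^esub> \<phi> L x \<otimes>\<^bsub>K\<^esub> B x = \<zero>\<^bsub>K\<^esub>" if x: "x \<in> carrier G" for x
  proof -
    have "\<zero>\<^bsub>K\<^esub> = (\<Oplus>\<^bsub>K\<^esub>T\<in>P \<union> insert L ` P. c T \<otimes>\<^bsub>K\<^esub> m T x)"
      using Suc.prems(2)[OF x] by (simp add: Pow_Suc m_def)
    also have "\<dots> = A x \<oplus>\<^bsub>K\<^esub> (\<Oplus>\<^bsub>K\<^esub>T\<in>insert L ` P. c T \<otimes>\<^bsub>K\<^esub> m T x)"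
      unfolding A_def using P disj c m x Pow_Suc by (intro K.finsum_Un_disjoint) auto
    also have "(\<Oplus>\<^bsub>K\<^esub>T\<in>insert L ` P. c T \<otimes>\<^bsub>K\<^esub> m T x) = (\<Oplus>\<^bsub>K\<^esub>T\<in>P. c1 T \<otimes>\<^bsub>K\<^esub> m (insert L T) x)"
      unfolding c1_def using inj c m x Pow_Suc by (intro K.finsum_reindex) auto
    also have "\<dots> = (\<Oplus>\<^bsub>K\<^esub>T\<in>P. \<phi> L x \<otimes>\<^bsub>K\<^esub> (c1 T \<otimes>\<^bsub>K\<^esub> m T x))"
    proof (rule K.finsum_cong')
      fix T assume T: "T \<in> P"
      have "\<phi> i x \<in> carrier K" if "i \<in> T" for i using that T x by (auto intro!: \<phi> simp: P_def)
      then have "m (insert L T) x = \<phi> L x \<otimes>\<^bsub>K\<^esub> m T x"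
        unfolding m_def using TP[OF T] \<phi>[OF _ x] by (intro K.finprod_insert) auto
      then show "c1 T \<otimes>\<^bsub>K\<^esub> m (insert L T) x = \<phi> L x \<otimes>\<^bsub>K\<^esub> (c1 T \<otimes>\<^bsub>K\<^esub> m T x)"
        using c1[OF T] m[OF TP(4)[OF T] x] \<phi>[OF _ x, of L] by (simp add: K.m_ac)
    qed (use c1 m TP x \<phi> in auto)
    also have "\<dots> = \<phi> L x \<otimes>\<^bsub>K\<^esub> B x"
      unfolding B_def using P c1 m TP x \<phi> by (intro K.finsum_rdistr[symmetric]) auto
    finally show ?thesis by simp
  qed
  have gL: "g L \<in> carrier G" using Suc.prems(5) by simp
  have m_inv: "m T (x \<otimes>\<^bsub>G\<^esub> g L) = m T x" if T: "T \<in> P" and x: "x \<in> carrier G" for T x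
    unfolding m_def
  proof (rule K.finprod_cong')
    fix i assume "i \<in> T"
    then have i: "i < L" using T by (auto simp: P_def)
    then show "\<phi> i (x \<otimes>\<^bsub>G\<^esub> g L) = \<phi> i x" using Suc.prems(7)[of i L x] x by simp
  qed (use T x in \<open>auto intro!: \<phi> simp: P_def\<close>)
  have B0: "B x = \<zero>\<^bsub>K\<^esub>" if x: "x \<in> carrier G" for x
  proof -
    have xg: "x \<otimes>\<^bsub>G\<^esub> g L \<in> carrier G" using x gL by simp
    have "A (x \<otimes>\<^bsub>G\<^esub> g L) = A x"
      unfolding A_def using c m TP x m_inv by (intro K.finsum_cong') auto
    moreover have "B (x \<otimes>\<^bsub>G\<^esub> g L) = B x"
      unfolding B_def using c1 m TP x m_inv by (intro K.finsum_cong') auto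
    ultimately have "A x \<oplus>\<^bsub>K\<^esub> (\<phi> L x \<oplus>\<^bsub>K\<^esub> \<one>\<^bsub>K\<^esub>) \<otimes>\<^bsub>K\<^esub> B x = \<zero>\<^bsub>K\<^esub>"
      using decomp[OF xg] Suc.prems(6)[of L x] x by simp
    then have "(A x \<oplus>\<^bsub>K\<^esub> \<phi> L x \<otimes>\<^bsub>K\<^esub> B x) \<oplus>\<^bsub>K\<^esub> B x = \<zero>\<^bsub>K\<^esub>"
      using AB[OF x] \<phi>[OF _ x, of L] by (simp add: K.l_distr K.a_assoc)
    then show ?thesis using decomp[OF x] AB[OF x] by simp
  qed
  have A0: "A x = \<zero>\<^bsub>K\<^esub>" if "x \<in> carrier G" for x
    using decomp[OF that] B0[OF that] AB[OF that] \<phi>[OF _ that, of L] by simp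
  have cz: "c T = \<zero>\<^bsub>K\<^esub>" if "T \<in> P" for T
  proof (rule Suc.IH)
    show "c \<in> Pow {..<L} \<rightarrow> carrier K" using c[OF TP(4)] by (auto simp: P_def)
    show "(\<Oplus>\<^bsub>K\<^esub>T\<in>Pow {..<L}. c T \<otimes>\<^bsub>K\<^esub> (\<Otimes>\<^bsub>K\<^esub>i\<in>T. \<phi> i x)) = \<zero>\<^bsub>K\<^esub>" if "x \<in> carrier G" for x
      using A0[OF that] by (simp add: A_def P_def m_def)
  qed (use Suc.prems that in \<open>auto simp: P_def\<close>)
  have c1z: "c1 T = \<zero>\<^bsub>K\<^esub>" if "T \<in> P" for T
  proof (rule Suc.IH)
    show "c1 \<in> Pow {..<L} \<rightarrow> carrier K" using c1 by (auto simp: P_def)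
    show "(\<Oplus>\<^bsub>K\<^esub>T\<in>Pow {..<L}. c1 T \<otimes>\<^bsub>K\<^esub> (\<Otimes>\<^bsub>K\<^esub>i\<in>T. \<phi> i x)) = \<zero>\<^bsub>K\<^esub>" if "x \<in> carrier G" for x
      using B0[OF that] by (simp add: B_def P_def m_def)
  qed (use Suc.prems that in \<open>auto simp: P_def\<close>)
  have "T \<in> P \<or> (\<exists>T'\<in>P. T = insert L T')" using Suc.prems(3) Pow_Suc by blast
  then show ?case using cz c1z by (auto simp: c1_def)
qed

lemma finite_ball: "finite S \<Longrightarrow> finite {word_product G w | w. set w \<subseteq> S \<and> length w \<le> n}"
  using finite_imageI[OF finite_lists_length_le[of S n], of "word_product G"]
  by (simp add: image_def conj_commute)

text \<open>
  If the ball had fewer than \<open>2\<^sup>L\<close> points, some nontrivial combination of the \<open>2\<^sup>L\<close> monomials would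
  vanish on it; its degree is at most the radius, so it would vanish everywhere.
\<close>

theorem growth_ge_card_monomials:
  assumes S: "finite S" "generates_as_semigroup G S"
    and \<phi>: "\<And>i. i < L \<Longrightarrow> poly_fun (Suc (w i)) (\<phi> i)" and g: "\<And>i. i < L \<Longrightarrow> g i \<in> carrier G"
    and one: "\<And>i u. i < L \<Longrightarrow> u \<in> carrier G \<Longrightarrow> \<phi> i (u \<otimes>\<^bsub>G\<^esub> g i) = \<phi> i u \<oplus>\<^bsub>K\<^esub> \<one>\<^bsub>K\<^esub>"
    and inv: "\<And>i j u. i < j \<Longrightarrow> j < L \<Longrightarrow> u \<in> carrier G \<Longrightarrow> \<phi> i (u \<otimes>\<^bsub>G\<^esub> g j) = \<phi> i u"
  shows "2 ^ L \<le> growth_function G S (\<Sum>i<L. w i)"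
proof (rule ccontr)
  define W where "W = (\<Sum>i<L. w i)"
  define E where "E = {word_product G w | w. set w \<subseteq> S \<and> length w \<le> W}"
  have SG: "S \<subseteq> carrier G" using S by (simp add: generates_as_semigroup_def)
  have E: "finite E" "E \<subseteq> carrier G"
    unfolding E_def using finite_ball[OF S(1)] word_product_closed SG by auto
  assume "\<not> 2 ^ L \<le> growth_function G S (\<Sum>i<L. w i)"
  then have card: "card E < card (Pow {..<L})"
    by (simp add: growth_function_def E_def W_def card_Pow)
  define m where "m x T = (\<Otimes>\<^bsub>K\<^esub>i\<in>T. \<phi> i x)" for x T
  have pm: "poly_fun (Suc W) (\<lambda>x. m x T)" if "T \<in> Pow {..<L}" for T
  proof (rule poly_fun_mono)
    show "poly_fun (Suc (sum w T)) (\<lambda>x. m x T)"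
      unfolding m_def using that finite_subset[of T "{..<L}"] by (intro poly_fun_finprod \<phi>) auto
    show "Suc (sum w T) \<le> Suc W" unfolding W_def using that by (auto intro!: sum_mono2)
  qed
  have "\<exists>c. c \<in> Pow {..<L} \<rightarrow> carrier K \<and> (\<exists>T\<in>Pow {..<L}. c T \<noteq> \<zero>\<^bsub>K\<^esub>) \<and>
      (\<forall>x\<in>E. (\<Oplus>\<^bsub>K\<^esub>T\<in>Pow {..<L}. c T \<otimes>\<^bsub>K\<^esub> m x T) = \<zero>\<^bsub>K\<^esub>)"
  proof (rule K.homogeneous_system_solution[OF E(1) _ card])
    fix x T assume "x \<in> E" "T \<in> Pow {..<L}"
    then show "m x T \<in> carrier K" using poly_fun_closed[OF pm] E(2) by blast
  qed simp
  then obtain c where c: "c \<in> Pow {..<L} \<rightarrow> carrier K" "\<exists>T\<in>Pow {..<L}. c T \<noteq> \<zero>\<^bsub>K\<^esub>"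
    "\<forall>x\<in>E. (\<Oplus>\<^bsub>K\<^esub>T\<in>Pow {..<L}. c T \<otimes>\<^bsub>K\<^esub> m x T) = \<zero>\<^bsub>K\<^esub>"
    by (elim exE conjE)
  define f where "f x = (\<Oplus>\<^bsub>K\<^esub>T\<in>Pow {..<L}. c T \<otimes>\<^bsub>K\<^esub> m x T)" for x
  have "poly_fun (Suc W) f"
    unfolding f_def using c(1) pm by (intro poly_fun_finsum poly_fun_smult) auto
  then have "f x = \<zero>\<^bsub>K\<^esub>" if "x \<in> carrier G" for x
  proof (rule poly_fun_eq_zero[OF S(2) _ _ that])
    fix v assume "set v \<subseteq> S" "length v < Suc W"
    then have "word_product G v \<in> E" by (auto simp: E_def)
    then show "f (word_product G v) = \<zero>\<^bsub>K\<^esub>" using c(3) by (simp add: f_def)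
  qed
  then have "c T = \<zero>\<^bsub>K\<^esub>" if "T \<subseteq> {..<L}" for T
    using monomials_independent[of L \<phi> g c T] poly_fun_closed[OF \<phi>] g one inv c(1) that
    by (auto simp: f_def m_def)
  then show False using c(2) by auto
qed

end

lemma (in field_and_group) growth_mono:
  "finite S \<Longrightarrow> m \<le> n \<Longrightarrow> growth_function G S m \<le> growth_function G S n"
  unfolding growth_function_def by (rule card_mono[OF finite_ball]) auto

text \<open>
  Triangular systems of size \<open>k\<close> on the levels from \<open>m\<close> to \<open>2 m - 1\<close> are strung together in
  increasing order of levels, the item \<open>i\<close> being number \<open>i mod k\<close> on level \<open>m + i div k\<close>. Restricting
  to these levels keeps every degree between \<open>m\<close> and \<open>2 m\<close>, so that the total degree is at most
  \<open>2 m\<close> times the number of items.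
\<close>

lemma (in field_and_group) growth_ge_of_rank:
  assumes K: "prime_field K" and S: "finite S" "generates_as_semigroup G S"
    and rank: "\<And>n. m \<le> n \<Longrightarrow> n < 2 * m \<Longrightarrow> k \<le> dimension_rank K G n"
  shows "2 ^ (m * k) \<le> growth_function G S (2 * m * m * k)"
proof -
  have "\<exists>g \<phi>. triangular_system n k g \<phi>" if "m \<le> n" "n < 2 * m" for n
    by (rule triangular_system_exists[OF K rank[OF that]])
  then obtain g \<phi> where "\<forall>n. m \<le> n \<and> n < 2 * m \<longrightarrow> triangular_system n k (g n) (\<phi> n)"
    by metis
  then have sys: "triangular_system n k (g n) (\<phi> n)" if "m \<le> n" "n < 2 * m" for n
    using that by blast
  define lev where "lev i = m + i div k" for i
  define idx where "idx i = i mod k" for i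
  have lev: "m \<le> lev i" "lev i < 2 * m" and idx: "idx i < k" if "i < m * k" for i
  proof -
    have "k > 0" using that by (cases k) auto
    moreover have "i div k < m" using that by (simp add: less_mult_imp_div_less)
    ultimately show "m \<le> lev i" "lev i < 2 * m" "idx i < k" by (auto simp: lev_def idx_def)
  qed
  have item: "g (lev i) (idx i) \<in> D (lev i)" "poly_fun (Suc (lev i)) (\<phi> (lev i) (idx i))"
    "\<phi> (lev i) (idx i) \<one>\<^bsub>G\<^esub> = \<zero>\<^bsub>K\<^esub>" "\<phi> (lev i) (idx i) (g (lev i) (idx i)) = \<one>\<^bsub>K\<^esub>" if "i < m * k" for i
    using sys[OF lev[OF that]] idx[OF that] by (auto simp: triangular_system_def simp del: poly_fun.simps)
  have "2 ^ (m * k) \<le> growth_function G S (\<Sum>i<m * k. lev i)"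
  proof (rule growth_ge_card_monomials[OF S])
    fix i assume i: "i < m * k"
    show "poly_fun (Suc (lev i)) (\<phi> (lev i) (idx i))" by (rule item(2)[OF i])
    show "g (lev i) (idx i) \<in> carrier G" using item(1)[OF i] by (rule D_carrier)
    fix u assume u: "u \<in> carrier G"
    show "\<phi> (lev i) (idx i) (u \<otimes>\<^bsub>G\<^esub> g (lev i) (idx i)) = \<phi> (lev i) (idx i) u \<oplus>\<^bsub>K\<^esub> \<one>\<^bsub>K\<^esub>"
      using D_additive[OF item(1-3)[OF i] u] item(4)[OF i] by simp
  next
    fix i j u assume ij: "i < j" and j: "j < m * k" and u: "u \<in> carrier G"
    have i: "i < m * k" using ij j by simp
    have "lev i \<le> lev j" using ij by (simp add: lev_def div_le_mono)
    then consider "lev i < lev j" | "lev i = lev j" by linarith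
    then show "\<phi> (lev i) (idx i) (u \<otimes>\<^bsub>G\<^esub> g (lev j) (idx j)) = \<phi> (lev i) (idx i) u"
    proof cases
      case 1
      then have "g (lev j) (idx j) \<in> D (Suc (lev i))"
        using item(1)[OF j] D_antimono[of "Suc (lev i)" "lev j"] by auto
      then show ?thesis using item(2)[OF i] u by (rule D_invisible)
    next
      case 2
      then have "i div k = j div k" by (simp add: lev_def)
      then have "i div k * k = j div k * k" by simp
      then have "idx i < idx j"
        using ij div_mult_mod_eq[of i k] div_mult_mod_eq[of j k] unfolding idx_def by linarith
      then have "\<phi> (lev i) (idx i) (g (lev j) (idx j)) = \<zero>\<^bsub>K\<^esub>"
        using sys[OF lev[OF i]] idx[OF i] idx[OF j] 2 by (simp add: triangular_system_def)
      moreover have "\<phi> (lev i) (idx i) u \<in> carrier K" by (rule poly_fun_closed[OF item(2)[OF i] u])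
      ultimately show ?thesis
        using D_additive[OF item(1)[OF j], of "\<phi> (lev i) (idx i)" u] item(2,3)[OF i] 2 u by simp
    qed
  qed
  also have "\<dots> \<le> growth_function G S (2 * m * m * k)"
  proof (rule growth_mono[OF S(1)])
    have "(\<Sum>i<m * k. lev i) \<le> (\<Sum>i<m * k. 2 * m)"
      using lev by (intro sum_mono) (simp add: less_imp_le)
    then show "(\<Sum>i<m * k. lev i) \<le> 2 * m * m * k" by (simp add: mult_ac)
  qed
  finally show ?thesis .
qed

section \<open>Asymptotics\<close>

text \<open>
  With \<open>k\<close> about \<open>C m powr d\<close> the hypothesis \<open>growth\<close> says that \<open>\<gamma>\<close>, at an argument of order
  \<open>m powr (d + 2)\<close>, is at least \<open>2\<close> to the power \<open>C m powr (d + 1)\<close>. Choosing \<open>m\<close> of order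
  \<open>x powr (1 / (d + 2))\<close> makes the argument linear in \<open>x\<close>, and the exponent acquires the order of
  \<open>x powr ((d + 1) / (d + 2))\<close>.
\<close>

lemma exp_power_dominated:
  fixes \<gamma> :: "nat \<Rightarrow> nat" and b :: "nat \<Rightarrow> nat" and C d :: real
  assumes C: "C > 0" and d: "d \<ge> 0" and b: "\<And>n. n \<ge> 1 \<Longrightarrow> real (b n) \<ge> C * real n powr d"
    and mono: "\<And>m n. m \<le> n \<Longrightarrow> \<gamma> m \<le> \<gamma> n"
    and growth: "\<And>m k. m \<ge> 1 \<Longrightarrow> (\<And>n. m \<le> n \<Longrightarrow> n < 2 * m \<Longrightarrow> k \<le> b n) \<Longrightarrow> 2 ^ (m * k) \<le> \<gamma> (2 * m * m * k)"
  shows "asymp_dominated (seq_fun (\<lambda>n. exp (real n powr (1 - 1 / (d + 2))))) (seq_fun (\<lambda>n. real (\<gamma> n)))"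
proof -
  define p where "p = d + 2"
  have p: "p \<ge> 2" using d by (simp add: p_def)
  define q where "q = 1 - 1 / p"
  have q: "q > 0" "q = (d + 1) / p" using p by (auto simp: q_def p_def field_simps)
  \<comment> \<open>\<open>A\<close> is the factor in the choice of \<open>m\<close>; it absorbs the constants \<open>C\<close> and \<open>ln 2\<close> in the exponent.\<close>
  define A where "A = max 1 (1 / (C * ln 2))"
  have A: "A \<ge> 1" "C * ln 2 * A \<ge> 1"
  proof -
    show "A \<ge> 1" by (simp add: A_def)
    have "1 = C * ln 2 * (1 / (C * ln 2))" using C by simp
    also have "\<dots> \<le> C * ln 2 * A" using C by (intro mult_left_mono) (auto simp: A_def)
    finally show "C * ln 2 * A \<ge> 1" .
  qed
  \<comment> \<open>\<open>C1\<close> bounds the ratio of the radius \<open>2 m\<^sup>2 k\<close> to \<open>x\<close>.\<close>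
  define C1 where "C1 = 2 * (C + 1) * (2 * A) powr p"
  have C1: "C1 > 0" using C A by (simp add: C1_def)
  have key: "exp (x powr q) \<le> real (\<gamma> (nat \<lfloor>C1 * x\<rfloor>))" if x: "x \<ge> 1" for x :: real
  proof -
    define m where "m = nat \<lceil>A * x powr (1 / p)\<rceil>"
    have x1: "x powr (1 / p) \<ge> 1" using x p by (simp add: ge_one_powr_ge_zero)
    have Ax: "A * x powr (1 / p) \<ge> 1" using A(1) x1 mult_mono[of 1 A 1 "x powr (1 / p)"] by simp
    have m_ge: "real m \<ge> A * x powr (1 / p)" unfolding m_def by linarith
    have m_le: "real m \<le> 2 * A * x powr (1 / p)" using Ax unfolding m_def by linarith
    have m1: "m \<ge> 1" using m_ge Ax by linarith
    define k where "k = nat \<lceil>C * real m powr d\<rceil>"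
    have md: "real m powr d \<ge> 1" using m1 d by (simp add: ge_one_powr_ge_zero)
    have k_ge: "real k \<ge> C * real m powr d" unfolding k_def by linarith
    have "real k \<le> C * real m powr d + 1"
    proof -
      have "0 \<le> C * real m powr d" using C by simp
      then show ?thesis unfolding k_def by linarith
    qed
    then have k_le: "real k \<le> (C + 1) * real m powr d" using md by (simp add: algebra_simps)
    have kb: "k \<le> b n" if "m \<le> n" "n < 2 * m" for n
    proof -
      have "C * real m powr d \<le> C * real n powr d"
        using C d that by (intro mult_left_mono powr_mono2) auto
      also have "\<dots> \<le> real (b n)" using b[of n] m1 that by simp
      finally show ?thesis unfolding k_def by linarith
    qed
    have "2 ^ (m * k) \<le> \<gamma> (2 * m * m * k)" by (rule growth[OF m1 kb])
    then have "real (2 ^ (m * k)) \<le> real (\<gamma> (2 * m * m * k))" by (rule of_nat_mono)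
    then have g1: "2 ^ (m * k) \<le> real (\<gamma> (2 * m * m * k))" by simp
    have "x powr q \<le> C * ln 2 * A * x powr q" using A(2) by (simp add: mult_le_cancel_right1)
    also have "\<dots> \<le> C * ln 2 * A powr (d + 1) * x powr q"
    proof -
      have "A powr 1 \<le> A powr (d + 1)" using A(1) d by (intro powr_mono) auto
      then show ?thesis using A(1) C by (intro mult_right_mono mult_left_mono) auto
    qed
    also have "\<dots> = C * ln 2 * (A * x powr (1 / p)) powr (d + 1)"
      using A(1) x q(2) by (simp add: powr_mult powr_powr)
    also have "\<dots> \<le> C * ln 2 * real m powr (d + 1)"
      using C A(1) d m_ge by (intro mult_left_mono powr_mono2) auto
    also have "\<dots> = real m * (C * real m powr d) * ln 2" using m1 by (simp add: powr_add)
    also have "\<dots> \<le> real m * real k * ln 2"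
      using k_ge by (intro mult_right_mono mult_left_mono) auto
    finally have "exp (x powr q) \<le> exp (real (m * k) * ln 2)" by simp
    also have "\<dots> = 2 ^ (m * k)" by (simp add: exp_of_nat_mult del: of_nat_mult)
    also note g1
    also have "real (\<gamma> (2 * m * m * k)) \<le> real (\<gamma> (nat \<lfloor>C1 * x\<rfloor>))"
    proof -
      have "real (2 * m * m * k) = 2 * (real m * real m) * real k" by simp
      also have "\<dots> \<le> 2 * (real m * real m) * ((C + 1) * real m powr d)"
        using k_le by (intro mult_left_mono) auto
      also have "\<dots> = 2 * (C + 1) * real m powr p"
        using m1 by (simp add: p_def powr_add power2_eq_square powr_numeral)
      also have "\<dots> \<le> 2 * (C + 1) * (2 * A * x powr (1 / p)) powr p"
        using C p m_le by (intro mult_left_mono powr_mono2) auto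
      also have "\<dots> = C1 * x"
        using A(1) x p by (simp add: C1_def powr_mult powr_powr)
      finally have "2 * m * m * k \<le> nat \<lfloor>C1 * x\<rfloor>" by linarith
      then show ?thesis using mono by simp
    qed
    finally show ?thesis .
  qed
  define C' where "C' = C1 + 1"
  have C': "C' > 0" "C' \<ge> C1" "C' \<ge> 1"
    using C1 by (auto simp: C'_def)
  have "exp (real (nat \<lfloor>x\<rfloor>) powr q) \<le> C' + C' * real (\<gamma> (nat \<lfloor>C' * x + C'\<rfloor>))"
    if x: "x \<ge> 0" for x :: real
  proof (cases "x \<ge> 1")
    case True
    have "exp (real (nat \<lfloor>x\<rfloor>) powr q) \<le> exp (x powr q)"
      using x q(1) by (simp, intro powr_mono2) auto
    also have "\<dots> \<le> real (\<gamma> (nat \<lfloor>C1 * x\<rfloor>))" by (rule key[OF True])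
    also have "\<dots> \<le> real (\<gamma> (nat \<lfloor>C' * x + C'\<rfloor>))"
    proof -
      have "C1 * x \<le> C' * x + C'" using C' x mult_right_mono[of C1 C' x] by linarith
      then show ?thesis by (simp add: mono nat_mono floor_mono)
    qed
    also have "\<dots> \<le> C' * real (\<gamma> (nat \<lfloor>C' * x + C'\<rfloor>))"
      using C'(3) by (simp add: mult_le_cancel_right1)
    finally show ?thesis using C'(1) by simp
  next
    case False
    then have "\<lfloor>x\<rfloor> = 0" using x by linarith
    then have "exp (real (nat \<lfloor>x\<rfloor>) powr q) = 1" by simp
    also have "\<dots> \<le> C' + C' * real (\<gamma> (nat \<lfloor>C' * x + C'\<rfloor>))"
      using C'(1,3) by (intro add_increasing2) auto
    finally show ?thesis .
  qed
  then show ?thesis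
    using C'(1) unfolding asymp_dominated_def seq_fun_def q_def p_def by blast
qed

section \<open>Growth of groups with large dimension sections\<close>

theorem corollary2p7:
  fixes K :: "'k ring" and G :: "'g monoid"
  assumes "field K"
    and "finitely_generated_group G"
    and "(K \<simeq> (ring_of_type_algebra :: rat ring) \<and> residually nilpotent_group G) \<or>
         (\<exists>p::nat. prime p \<and> K \<simeq> residue_ring (int p) \<and> residually (finite_p_group p) G)"
  shows "(\<forall>C d :: real. C > 0 \<and> d \<ge> 0 \<and>
            (\<forall>n \<ge> 1. real (dimension_rank K G n) \<ge> C * real n powr d) \<longrightarrow>
            growth_dominates G (\<lambda>n. exp (real n powr (1 - 1 / (d + 2))))) \<and>
         ((\<forall>n \<ge> 1. dimension_rank K G n \<noteq> 0) \<longrightarrow>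
            growth_dominates G (\<lambda>n. exp (sqrt (real n))))"
proof -
  interpret field K by fact
  interpret group G using assms(2) by (simp add: finitely_generated_group_def)
  interpret field_and_group K G ..
  have K: "prime_field K"
    using assms(3)
  proof (elim disjE exE conjE)
    assume "K \<simeq> (ring_of_type_algebra :: rat ring)"
    then show ?thesis
      using prime_field_iso[OF ring_axioms ring_from_type_algebra _ prime_field_rat] by blast
  next
    fix p :: nat assume p: "prime p" "K \<simeq> residue_ring (int p)"
    interpret R: residues "int p" "residue_ring (int p)"
      by unfold_locales (use prime_gt_1_nat[OF p(1)] in auto)
    show ?thesis
      by (rule prime_field_iso[OF ring_axioms R.ring_axioms p(2) prime_field_residue_ring[OF p(1)]])
  qed
  have main: "growth_dominates G (\<lambda>n. exp (real n powr (1 - 1 / (d + 2))))"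
    if "C > 0" "d \<ge> 0" "\<And>n. n \<ge> 1 \<Longrightarrow> real (dimension_rank K G n) \<ge> C * real n powr d" for C d :: real
    unfolding growth_dominates_def
  proof (intro allI impI, elim conjE)
    fix S assume S: "finite S" "generates_as_semigroup G S"
    show "asymp_dominated (seq_fun (\<lambda>n. exp (real n powr (1 - 1 / (d + 2)))))
        (seq_fun (\<lambda>n. real (growth_function G S n)))"
      using that by (rule exp_power_dominated) (use growth_mono growth_ge_of_rank K S in auto)
  qed
  moreover have "growth_dominates G (\<lambda>n. exp (sqrt (real n)))"
    if rank: "\<forall>n \<ge> 1. dimension_rank K G n \<noteq> 0"
  proof -
    have "real (dimension_rank K G n) \<ge> 1 * real n powr 0" if "n \<ge> 1" for n
      using rank that by (auto simp: Suc_le_eq)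
    from main[OF _ _ this] show ?thesis by (simp add: powr_half_sqrt)
  qed
  ultimately show ?thesis by blast
qed

end
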